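(* Let $\Phi$ be a Perron family of (densities of) SK-metrics on a domain $G\subseteq\mathbb{C}$. If $\Phi\neq\emptyset$, then $$\lambda_\Phi(z):=\sup_{\lambda\in\Phi}\lambda(z)$$ induces a regular conformal metric $\lambda_\Phi(z)\,|dz|$ of constant curvature $-1$ on $G$.
   Context: A conformal pseudo-metric $\lambda(z)\,|dz|$ on $G$ is given by a continuous function $\lambda:G\to[0,+\infty)$, $\lambda\not\equiv 0$ (its density); it is a conformal metric if $\lambda>0$ on $G$, and it is regular if $\lambda$ is of class $C^2$ on $\{\lambda>0\}$. For a continuous real-valued function $u$ near a point $z$, the generalized lower Laplace operator is $\Delta u(z)=\liminf_{r\to 0}\frac{4}{r^2}\left(\frac{1}{2\pi}\int_0^{2\pi}u(z+re^{it})\,dt-u(z)\right)$ (equal to the usual Laplacian if $u$ is $C^2$ near $z$). Where $\lambda(z)>0$ the curvature is $\kappa_\lambda(z)=-\Delta(\log\lambda)(z)/\lambda(z)^2$. The pseudo-metric $\lambda(z)\,|dz|$ is an SK-metric on $G$ if $\kappa_\lambda\le -1$ at every point where $\lambda>0$. Modification: for an SK-metric $\lambda(z)\,|dz|$ on $G$ and an open disk $K$ compactly contained in $G$, $M_K\lambda(z)\,|dz|$ denotes the unique SK-metric on $G$ such that $M_K\lambda=\lambda$ on $G\setminus K$ and such that $M_K\lambda(z)\,|dz|$ is a regular conformal metric on $K$ with constant curvature $-1$. A family $\Phi$ of densities of SK-metrics on $G$ is a Perron family if (i) $\lambda,\mu\in\Phi$ implies $\max\{\lambda,\mu\}\in\Phi$,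 and (ii) $\lambda\in\Phi$ implies $M_K\lambda\in\Phi$ for every open disk $K$ compactly contained in $G$. *)

theory Defs
  imports "HOL-Analysis.Analysis"
begin

text \<open>
  Densities on \<open>G\<close> are represented by total functions \<open>complex \<Rightarrow> real\<close>, of which only the
  values on \<open>G\<close> matter.
\<close>

definition conformal_pseudo_metric :: "complex set \<Rightarrow> (complex \<Rightarrow> real) \<Rightarrow> bool" where
  "conformal_pseudo_metric G \<rho> \<longleftrightarrow>
     continuous_on G \<rho> \<and> (\<forall>z\<in>G. 0 \<le> \<rho> z) \<and> (\<exists>z\<in>G. \<rho> z \<noteq> 0)"

definition conformal_metric :: "complex set \<Rightarrow> (complex \<Rightarrow> real) \<Rightarrow> bool" where
  "conformal_metric G \<rho> \<longleftrightarrow> conformal_pseudo_metric G \<rho> \<and> (\<forall>z\<in>G. 0 < \<rho> z)"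

text \<open>
  Class \<open>C\<^sup>2\<close> in the real sense (\<open>complex\<close> as a real vector space), on an open set:
  \<open>f'\<close> and \<open>f''\<close> are the first and second Frechet derivatives.
\<close>

definition C2_on :: "complex set \<Rightarrow> (complex \<Rightarrow> real) \<Rightarrow> bool" where
  "C2_on S f \<longleftrightarrow>
     (\<exists>(f' :: complex \<Rightarrow> complex \<Rightarrow>\<^sub>L real) (f'' :: complex \<Rightarrow> complex \<Rightarrow>\<^sub>L complex \<Rightarrow>\<^sub>L real).
        (\<forall>z\<in>S. (f has_derivative blinfun_apply (f' z)) (at z)) \<and>
        (\<forall>z\<in>S. (f' has_derivative blinfun_apply (f'' z)) (at z)) \<and>
        continuous_on S f'')"

definition regular_on :: "complex set \<Rightarrow> (complex \<Rightarrow> real) \<Rightarrow> bool" where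
  "regular_on G \<rho> \<longleftrightarrow> C2_on {z\<in>G. 0 < \<rho> z} \<rho>"

text \<open>The lower limit may be infinite, hence the values in \<open>ereal\<close>.\<close>

definition lower_laplacian :: "(complex \<Rightarrow> real) \<Rightarrow> complex \<Rightarrow> ereal" where
  "lower_laplacian u z =
     Liminf (at_right (0::real)) (\<lambda>r. ereal
       (4 / r\<^sup>2 * (1 / (2 * pi) * integral {0..2 * pi} (\<lambda>t. u (z + of_real r * cis t)) - u z)))"

text \<open>
  Only meaningful where \<open>\<rho> z > 0\<close>; by continuity \<open>ln (\<rho> w)\<close> is then the true logarithm for
  all \<open>w\<close> near \<open>z\<close>, and the lower limit depends on those \<open>w\<close> only.
\<close>

definition curvature :: "(complex \<Rightarrow> real) \<Rightarrow> complex \<Rightarrow> ereal" where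
  "curvature \<rho> z = - lower_laplacian (\<lambda>w. ln (\<rho> w)) z / ereal ((\<rho> z)\<^sup>2)"

definition sk_metric :: "complex set \<Rightarrow> (complex \<Rightarrow> real) \<Rightarrow> bool" where
  "sk_metric G \<rho> \<longleftrightarrow>
     conformal_pseudo_metric G \<rho> \<and> (\<forall>z\<in>G. 0 < \<rho> z \<longrightarrow> curvature \<rho> z \<le> -1)"

definition regular_metric_curvature_minus_one :: "complex set \<Rightarrow> (complex \<Rightarrow> real) \<Rightarrow> bool" where
  "regular_metric_curvature_minus_one G \<rho> \<longleftrightarrow>
     conformal_metric G \<rho> \<and> regular_on G \<rho> \<and> (\<forall>z\<in>G. curvature \<rho> z = -1)"

text \<open>
  \<open>is_modification G K \<rho> \<sigma>\<close> is the defining property of \<open>\<sigma> = M\<^sub>K \<rho>\<close>. It determines \<open>\<sigma>\<close> on \<open>G\<close>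
  but not outside \<open>G\<close>, so it is stated as a relation rather than as a function of \<open>\<rho>\<close>.
\<close>

definition is_modification ::
    "complex set \<Rightarrow> complex set \<Rightarrow> (complex \<Rightarrow> real) \<Rightarrow> (complex \<Rightarrow> real) \<Rightarrow> bool" where
  "is_modification G K \<rho> \<sigma> \<longleftrightarrow>
     sk_metric G \<sigma> \<and> (\<forall>z\<in>G - K. \<sigma> z = \<rho> z) \<and> regular_metric_curvature_minus_one K \<sigma>"

text \<open>The last clause says that \<open>M\<^sub>K \<rho> \<in> \<Phi>\<close>, as a density on \<open>G\<close>, for \<open>K = ball a r\<close>.\<close>

definition perron_family :: "complex set \<Rightarrow> (complex \<Rightarrow> real) set \<Rightarrow> bool" where
  "perron_family G \<Phi> \<longleftrightarrow>
     (\<forall>\<rho>\<in>\<Phi>. sk_metric G \<rho>) \<and>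
     (\<forall>\<rho>\<in>\<Phi>. \<forall>\<sigma>\<in>\<Phi>. (\<lambda>z. max (\<rho> z) (\<sigma> z)) \<in> \<Phi>) \<and>
     (\<forall>\<rho>\<in>\<Phi>. \<forall>a r. 0 < r \<longrightarrow> cball a r \<subseteq> G \<longrightarrow>
        (\<exists>\<sigma>\<in>\<Phi>. is_modification G (ball a r) \<rho> \<sigma>))"

end

theory Submission
  imports Defs
begin

text \<open>
  The proof is Perron's method for the Liouville equation \<open>\<Delta>s = e\<^sup>2\<^sup>s\<close>, which \<open>s = ln \<rho>\<close>
  satisfies exactly when \<open>\<rho>\<close> has curvature \<open>-1\<close>.

  Two applications of the maximum principle give order relations. Comparison with the
  hyperbolic density of a disk (\<open>sk_metric_bound\<close>) bounds all SK-metrics locally uniformly, so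
  the supremum is finite. Comparison with a metric of curvature \<open>-1\<close>
  (\<open>sk_metric_le_curvature_minus_one\<close>) shows that modification does not decrease a density that
  is positive on the boundary of the disk. Near a given point this positivity can be arranged: a
  finite maximum of modifications is a member \<open>\<mu>\<close> of the family that is positive on a closed
  disk, and replacing \<open>\<rho>\<close> by \<open>max \<rho> \<mu>\<close> does not change the supremum. On the disk the supremum
  is therefore one of solutions of the Liouville equation, bounded above and below.

  It remains to see that this supremum is again a solution, in particular of class \<open>C\<^sup>2\<close>.
  The tool is \<open>gradient_representation\<close>, an explicit formula for the gradient of \<open>s\<close> in terms
  of averages of translates of \<open>s\<close> and of \<open>\<Delta>s = e\<^sup>2\<^sup>s\<close>. It bounds the gradients, so the solutions
  are equicontinuous; since the family is closed under maxima, a single sequence of solutions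
  converges uniformly to the supremum. Passing to the limit in the formula shows that the
  limit is continuously differentiable; the formula can then be differentiated by letting the
  derivative act on the averaged functions, which gives the second derivatives and their
  convergence (\<open>liouville_uniform_limit\<close>).
\<close>

section \<open>The lower Laplacian\<close>

lemma circle_point_in_ball:
  assumes "0 < r" "r < e"
  shows "z + of_real r * cis t \<in> ball z e"
  using assms by (simp add: dist_norm norm_mult)

lemma eventually_at_right_0_less:
  "0 < e \<Longrightarrow> \<forall>\<^sub>F r in at_right (0::real). 0 < r \<and> r < e"
  using eventually_at_right_field by blast

lemma circle_integrable:
  fixes f :: "complex \<Rightarrow> 'a::banach"
  assumes "continuous_on U f" "\<And>t. z + of_real r * cis t \<in> U"
  shows "(\<lambda>t. f (z + of_real r * cis t)) integrable_on {a..b}"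
proof (rule integrable_continuous_real)
  show "continuous_on {a..b} (\<lambda>t. f (z + of_real r * cis t))"
    by (rule continuous_on_compose2[OF assms(1)]) (use assms(2) in \<open>auto intro!: continuous_intros\<close>)
qed

text \<open>
  This is the form in which the maximum principle enters: where \<open>f - g\<close> has a maximum, the
  lower Laplacians are ordered. The inequality holds for the circle means of
  each small radius, before the lower limit is taken.
\<close>

lemma lower_laplacian_mono_at:
  assumes U: "open U" "z \<in> U" "continuous_on U f" "continuous_on U g"
    and le: "\<And>w. w \<in> U \<Longrightarrow> f w - f z \<le> g w - g z"
  shows "lower_laplacian f z \<le> lower_laplacian g z"
proof -
  obtain e where e: "e > 0" "ball z e \<subseteq> U"
    using U openE by blast
  have "\<forall>\<^sub>F r in at_right (0::real). 0 < r \<and> r < e"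
    using e by (simp add: eventually_at_right_0_less)
  then show ?thesis
    unfolding lower_laplacian_def
  proof (intro Liminf_mono, eventually_elim)
    case (elim r)
    have inU: "z + of_real r * cis t \<in> U" for t
      using circle_point_in_ball[of r e z t] elim e by blast
    have "integral {0..2 * pi} (\<lambda>t. f (z + of_real r * cis t))
        \<le> integral {0..2 * pi} (\<lambda>t. g (z + of_real r * cis t) + (f z - g z))"
    proof (rule integral_le)
      show "(\<lambda>t. f (z + of_real r * cis t)) integrable_on {0..2 * pi}"
        by (rule circle_integrable[OF U(3) inU])
      show "(\<lambda>t. g (z + of_real r * cis t) + (f z - g z)) integrable_on {0..2 * pi}"
        by (intro integrable_add circle_integrable[OF U(4) inU] integrable_const_ivl)
    qed (use le[OF inU] in \<open>simp add: algebra_simps\<close>)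
    also have "\<dots> = integral {0..2 * pi} (\<lambda>t. g (z + of_real r * cis t)) + 2 * pi * (f z - g z)"
      by (subst integral_add) (auto intro!: circle_integrable[OF U(4) inU])
    finally have "1 / (2 * pi) * integral {0..2 * pi} (\<lambda>t. f (z + of_real r * cis t))
       \<le> 1 / (2 * pi) * (integral {0..2 * pi} (\<lambda>t. g (z + of_real r * cis t)) + 2 * pi * (f z - g z))"
      by (intro mult_left_mono) auto
    also have "\<dots> = 1 / (2 * pi) * integral {0..2 * pi} (\<lambda>t. g (z + of_real r * cis t)) + (f z - g z)"
      by (simp add: field_simps)
    finally have "1 / (2 * pi) * integral {0..2 * pi} (\<lambda>t. f (z + of_real r * cis t)) - f z
       \<le> 1 / (2 * pi) * integral {0..2 * pi} (\<lambda>t. g (z + of_real r * cis t)) - g z"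
      by simp
    then show ?case
      by (auto intro!: divide_right_mono mult_left_mono)
  qed
qed

lemma curvature_le_minus_one_iff:
  assumes "0 < \<rho> z"
  shows "curvature \<rho> z \<le> -1 \<longleftrightarrow> ereal ((\<rho> z)\<^sup>2) \<le> lower_laplacian (\<lambda>w. ln (\<rho> w)) z"
proof -
  have "0 < (\<rho> z)\<^sup>2" using assms by simp
  then show ?thesis
    unfolding curvature_def
    by (cases "lower_laplacian (\<lambda>w. ln (\<rho> w)) z") (auto simp: one_ereal_def field_simps)
qed

lemma curvature_eq_minus_one_iff:
  assumes "0 < \<rho> z"
  shows "curvature \<rho> z = -1 \<longleftrightarrow> lower_laplacian (\<lambda>w. ln (\<rho> w)) z = ereal ((\<rho> z)\<^sup>2)"
proof -
  have "0 < (\<rho> z)\<^sup>2" using assms by simp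
  then show ?thesis
    unfolding curvature_def
    by (cases "lower_laplacian (\<lambda>w. ln (\<rho> w)) z") (auto simp: one_ereal_def field_simps)
qed

section \<open>Maximum principles for SK-metrics\<close>

lemma sk_metric_continuous: "sk_metric G \<rho> \<Longrightarrow> continuous_on G \<rho>"
  by (auto simp: sk_metric_def conformal_pseudo_metric_def)

lemma sk_metric_nonneg: "sk_metric G \<rho> \<Longrightarrow> z \<in> G \<Longrightarrow> 0 \<le> \<rho> z"
  by (auto simp: sk_metric_def conformal_pseudo_metric_def)

text \<open>
  At a maximum of \<open>\<rho> / \<sigma>\<close> the function \<open>ln \<rho> - ln \<sigma>\<close> is maximal, so
  \<open>\<rho>\<^sup>2 \<le> \<Delta> (ln \<rho>) \<le> \<Delta> (ln \<sigma>)\<close> there. Both comparison results below apply this, with two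
  different choices of \<open>\<sigma>\<close>.
\<close>

lemma sk_metric_at_quotient_max:
  assumes sk: "sk_metric G \<rho>" and U: "open U" "U \<subseteq> G" "z \<in> U"
    and \<sigma>: "continuous_on U \<sigma>" "\<And>w. w \<in> U \<Longrightarrow> 0 < \<sigma> w"
    and pos: "0 < \<rho> z" and max: "\<And>w. w \<in> U \<Longrightarrow> \<rho> w / \<sigma> w \<le> \<rho> z / \<sigma> z"
  shows "ereal ((\<rho> z)\<^sup>2) \<le> lower_laplacian (\<lambda>w. ln (\<sigma> w)) z"
proof -
  have \<rho>: "continuous_on U \<rho>"
    using sk_metric_continuous[OF sk] U(2) by (rule continuous_on_subset)
  define V where "V = U \<inter> {w. 0 < \<rho> w}"
  have "V = U \<inter> \<rho> -` {0<..}" by (auto simp: V_def)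
  then have "open V" using continuous_open_preimage[OF \<rho> U(1)] by simp
  have zV: "z \<in> V" using U pos by (simp add: V_def)
  have "ereal ((\<rho> z)\<^sup>2) \<le> lower_laplacian (\<lambda>w. ln (\<rho> w)) z"
    using sk U pos curvature_le_minus_one_iff[of \<rho> z] by (auto simp: sk_metric_def)
  also have "\<dots> \<le> lower_laplacian (\<lambda>w. ln (\<sigma> w)) z"
  proof (rule lower_laplacian_mono_at[OF \<open>open V\<close> zV])
    show "continuous_on V (\<lambda>w. ln (\<rho> w))"
      by (intro continuous_on_ln continuous_on_subset[OF \<rho>]) (auto simp: V_def)
    show "continuous_on V (\<lambda>w. ln (\<sigma> w))"
      using \<sigma>(2) by (intro continuous_on_ln continuous_on_subset[OF \<sigma>(1)]) (force simp: V_def)+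
  next
    fix w assume "w \<in> V"
    then have w: "w \<in> U" "0 < \<rho> w" by (auto simp: V_def)
    have "ln (\<rho> w / \<sigma> w) \<le> ln (\<rho> z / \<sigma> z)"
      using max[OF w(1)] w \<sigma>(2)[OF w(1)] by (intro ln_mono) auto
    then show "ln (\<rho> w) - ln (\<rho> z) \<le> ln (\<sigma> w) - ln (\<sigma> z)"
      using w \<sigma>(2)[OF w(1)] \<sigma>(2)[OF U(3)] pos by (simp add: ln_div)
  qed
  finally show ?thesis .
qed

text \<open>
  If \<open>\<rho> / \<sigma>\<close> exceeded 1, its maximum would be attained inside the disk, and there
  \<open>\<rho>\<^sup>2 \<le> \<Delta> (ln \<sigma>) = \<sigma>\<^sup>2\<close>. Positivity of \<open>\<sigma>\<close> up to the boundary makes the quotient continuous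
  on the closed disk; at zeros on the circle the argument would break down.
\<close>

lemma sk_metric_le_curvature_minus_one:
  assumes sk: "sk_metric G \<rho>" and sub: "cball a r \<subseteq> G"
    and \<sigma>: "continuous_on (cball a r) \<sigma>" "\<And>w. w \<in> cball a r \<Longrightarrow> 0 < \<sigma> w"
    and curv: "\<And>w. w \<in> ball a r \<Longrightarrow> curvature \<sigma> w = -1"
    and bd: "\<And>w. w \<in> sphere a r \<Longrightarrow> \<rho> w \<le> \<sigma> w"
    and z: "z \<in> cball a r"
  shows "\<rho> z \<le> \<sigma> z"
proof -
  have \<rho>: "continuous_on (cball a r) \<rho>"
    using sk_metric_continuous[OF sk] sub by (rule continuous_on_subset)
  have "continuous_on (cball a r) (\<lambda>w. \<rho> w / \<sigma> w)"
    using \<rho> \<sigma> by (intro continuous_on_divide) force+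
  then obtain m where m: "m \<in> cball a r" "\<And>w. w \<in> cball a r \<Longrightarrow> \<rho> w / \<sigma> w \<le> \<rho> m / \<sigma> m"
    using continuous_attains_sup[OF compact_cball] z by blast
  have "\<rho> m \<le> \<sigma> m"
  proof (cases "m \<in> ball a r \<and> 0 < \<rho> m")
    case True
    have "ereal ((\<rho> m)\<^sup>2) \<le> lower_laplacian (\<lambda>w. ln (\<sigma> w)) m"
    proof (rule sk_metric_at_quotient_max[OF sk open_ball, where z = m])
      show "continuous_on (ball a r) \<sigma>"
        by (rule continuous_on_subset[OF \<sigma>(1)]) auto
      show "\<rho> w / \<sigma> w \<le> \<rho> m / \<sigma> m" if "w \<in> ball a r" for w
        using m(2) that ball_subset_cball by blast
      show "ball a r \<subseteq> G" using sub ball_subset_cball by blast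
    qed (use True \<sigma>(2) in auto)
    also have "\<dots> = ereal ((\<sigma> m)\<^sup>2)"
      using curvature_eq_minus_one_iff[of \<sigma> m] curv[of m] \<sigma>(2)[OF m(1)] True by simp
    finally show ?thesis
      using \<sigma>(2)[OF m(1)] power2_le_imp_le[of "\<rho> m" "\<sigma> m"] by simp
  next
    case False
    then consider "m \<in> sphere a r" | "\<rho> m \<le> 0"
      using m(1) by fastforce
    then show ?thesis
      by cases (use bd \<sigma>(2)[OF m(1)] in auto)
  qed
  then have "\<rho> m / \<sigma> m \<le> 1" using \<sigma>(2)[OF m(1)] by simp
  then have "\<rho> z / \<sigma> z \<le> 1" using m(2)[OF z] by linarith
  then show ?thesis using \<sigma>(2)[OF z] by simp
qed

lemma has_vector_derivative_cis:
  "(cis has_vector_derivative \<i> * cis t) (at t within S)"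
  unfolding has_vector_derivative_def by (rule has_derivative_cis) (rule has_derivative_ident)

lemma integral_cis: "integral {0..2*pi} cis = 0"
proof -
  have "((\<lambda>t. cis t) has_integral (- \<i> * cis (2 * pi) - (- \<i> * cis 0))) {0..2*pi}"
    by (rule fundamental_theorem_of_calculus)
       (auto intro!: derivative_eq_intros has_vector_derivative_cis)
  then show ?thesis by (simp add: integral_unique)
qed

lemma ln_one_minus_lower_bound:
  fixes x :: real
  assumes "\<bar>x\<bar> \<le> 1/2"
  shows "- ln (1 - x) \<le> x + 2 * x\<^sup>2"
proof (cases "x \<ge> 0")
  case True
  then show ?thesis using ln_one_minus_pos_lower_bound[of x] assms by simp
next
  case False
  have "- ln (1 - x) \<le> x + x\<^sup>2"
    using False ln_one_plus_pos_lower_bound[of "-x"] assms by simp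
  then show ?thesis using zero_le_power2[of x] by linarith
qed

text \<open>
  Up to a constant, \<open>1 / P\<close> is the hyperbolic density of the disk; the Laplacian of its
  logarithm is \<open>4 * r\<^sup>2 / P\<^sup>2\<close>. The constant 36 comes from estimating
  \<open>- ln (1 - x)\<close> by \<open>x + 2 * x\<^sup>2\<close> and the quadratic term by its maximum over the circle, which
  is enough for a locally uniform bound on SK-metrics.
\<close>

lemma lower_laplacian_hyperbolic_le:
  assumes z: "z \<in> ball a r"
  defines "P \<equiv> \<lambda>w. r\<^sup>2 - (norm (w - a))\<^sup>2"
  shows "lower_laplacian (\<lambda>w. ln (1 / P w)) z \<le> ereal (36 * r\<^sup>2 / (P z)\<^sup>2)"
proof -
  define N where "N = norm (z - a)"
  have N: "0 \<le> N" "N < r" using z by (auto simp: N_def dist_norm norm_minus_commute)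
  then have r: "0 < r" by linarith
  have Pz: "0 < P z" using N by (simp add: P_def N_def[symmetric] power_strict_mono)
  have Pzr: "P z \<le> r\<^sup>2" by (simp add: P_def)
  \<comment> \<open>The relative decrease of \<open>P\<close> from \<open>z\<close> to the point at angle \<open>t\<close> on the circle of radius \<open>\<rho>\<close>;
    its linear part has mean zero over the circle.\<close>
  define x where "x = (\<lambda>\<rho> t. (2 * \<rho> * Re (cnj (z - a) * cis t) + \<rho>\<^sup>2) / P z)"
  have Peq: "P (z + of_real \<rho> * cis t) = P z * (1 - x \<rho> t)" for \<rho> t
  proof -
    have "(norm (z + of_real \<rho> * cis t - a))\<^sup>2 = (Re (z - a) + \<rho> * cos t)\<^sup>2 + (Im (z - a) + \<rho> * sin t)\<^sup>2"
      by (simp add: cmod_power2 algebra_simps)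
    also have "\<dots> = (Re (z - a))\<^sup>2 + (Im (z - a))\<^sup>2 + 2 * \<rho> * (Re (z - a) * cos t + Im (z - a) * sin t)
        + \<rho>\<^sup>2 * ((cos t)\<^sup>2 + (sin t)\<^sup>2)"
      by algebra
    also have "\<dots> = N\<^sup>2 + 2 * \<rho> * Re (cnj (z - a) * cis t) + \<rho>\<^sup>2"
      by (simp add: N_def cmod_power2 algebra_simps)
    also have "2 * \<rho> * Re (cnj (z - a) * cis t) = P z * x \<rho> t - \<rho>\<^sup>2"
      using Pz by (simp add: x_def)
    finally have "P (z + of_real \<rho> * cis t) = P z - P z * x \<rho> t"
      by (simp add: P_def N_def)
    then show ?thesis by (simp add: right_diff_distrib)
  qed
  define b where "b = (\<lambda>\<rho>. (2 * \<rho> * N + \<rho>\<^sup>2) / P z)"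
  have xb: "\<bar>x \<rho> t\<bar> \<le> b \<rho>" if "0 \<le> \<rho>" for \<rho> t
  proof -
    have "\<bar>Re (cnj (z - a) * cis t)\<bar> \<le> N"
      by (rule order_trans[OF abs_Re_le_cmod]) (simp add: norm_mult N_def del: complex_cnj_diff)
    then have "\<bar>2 * \<rho> * Re (cnj (z - a) * cis t) + \<rho>\<^sup>2\<bar> \<le> 2 * \<rho> * N + \<rho>\<^sup>2"
      using that by (intro order_trans[OF abs_triangle_ineq] add_mono) (auto simp: abs_mult mult_left_mono)
    then show ?thesis using Pz by (simp add: x_def b_def divide_right_mono)
  qed
  have "(b \<longlongrightarrow> (2 * 0 * N + 0\<^sup>2) / P z) (at_right 0)"
    unfolding b_def using Pz by (intro tendsto_intros) auto
  then have "\<forall>\<^sub>F \<rho> in at_right 0. b \<rho> < 1/2"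
    by (rule order_tendstoD) simp
  moreover have "\<forall>\<^sub>F \<rho> in at_right (0::real). 0 < \<rho>"
    by (simp add: eventually_at_right_less)
  ultimately have ev: "\<forall>\<^sub>F \<rho> in at_right 0. 4 / \<rho>\<^sup>2 * (1 / (2 * pi) *
        integral {0..2 * pi} (\<lambda>t. ln (1 / P (z + of_real \<rho> * cis t))) - ln (1 / P z))
      \<le> 4 / P z + 8 * ((2 * N + \<rho>) / P z)\<^sup>2"
  proof eventually_elim
    case (elim \<rho>)
    have x2: "\<bar>x \<rho> t\<bar> \<le> 1/2" for t using xb[of \<rho> t] elim by linarith
    have ne: "1 - x \<rho> t \<noteq> 0" for t using x2[of t] by auto
    have lnP: "ln (1 / P (z + of_real \<rho> * cis t)) = ln (1 / P z) - ln (1 - x \<rho> t)" for t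
      using x2[of t] Pz by (simp add: Peq ln_div ln_mult)
    have cx: "continuous_on S (x \<rho>)" for S
      unfolding x_def using Pz by (intro continuous_intros) auto
    have intRe: "((\<lambda>t. Re (cnj (z - a) * cis t)) has_integral 0) {0..2*pi}"
    proof -
      have "cis integrable_on {0..2*pi}"
        by (intro integrable_continuous_real continuous_on_cis continuous_on_id)
      then have "(cis has_integral 0) {0..2*pi}"
        using integral_cis by (simp add: has_integral_iff)
      then have "((\<lambda>t. cnj (z - a) * cis t) has_integral cnj (z - a) * 0) {0..2*pi}"
        by (rule has_integral_mult_right)
      from has_integral_linear[OF this bounded_linear_Re] show ?thesis by (simp add: o_def)
    qed
    have I1: "((\<lambda>t. 2 * \<rho> / P z * Re (cnj (z - a) * cis t) + (\<rho>\<^sup>2 / P z + 2 * (b \<rho>)\<^sup>2 + ln (1 / P z)))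
        has_integral 2 * \<rho> / P z * 0 + (2 * pi - 0) *\<^sub>R (\<rho>\<^sup>2 / P z + 2 * (b \<rho>)\<^sup>2 + ln (1 / P z))) {0..2*pi}"
      using has_integral_const_real[of "\<rho>\<^sup>2 / P z + 2 * (b \<rho>)\<^sup>2 + ln (1 / P z)" 0 "2*pi"]
      by (intro has_integral_add has_integral_mult_right intRe) auto
    have I2: "((\<lambda>t. ln (1 / P (z + of_real \<rho> * cis t))) has_integral
        integral {0..2 * pi} (\<lambda>t. ln (1 / P (z + of_real \<rho> * cis t)))) {0..2*pi}"
      unfolding lnP
      by (intro integrable_integral integrable_continuous_real continuous_intros cx)
         (use ne in auto)
    have "integral {0..2 * pi} (\<lambda>t. ln (1 / P (z + of_real \<rho> * cis t)))
        \<le> 2 * \<rho> / P z * 0 + (2 * pi - 0) *\<^sub>R (\<rho>\<^sup>2 / P z + 2 * (b \<rho>)\<^sup>2 + ln (1 / P z))"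
    proof (rule has_integral_le[OF I2 I1])
      fix t :: real
      have "- ln (1 - x \<rho> t) \<le> x \<rho> t + 2 * (x \<rho> t)\<^sup>2"
        by (rule ln_one_minus_lower_bound[OF x2])
      also have "(x \<rho> t)\<^sup>2 \<le> (b \<rho>)\<^sup>2"
        using xb[of \<rho> t] elim by (metis abs_ge_zero less_imp_le power2_abs power_mono)
      finally show "ln (1 / P (z + of_real \<rho> * cis t))
          \<le> 2 * \<rho> / P z * Re (cnj (z - a) * cis t) + (\<rho>\<^sup>2 / P z + 2 * (b \<rho>)\<^sup>2 + ln (1 / P z))"
        by (simp add: lnP x_def add_divide_distrib)
    qed
    then have "1 / (2 * pi) * integral {0..2 * pi} (\<lambda>t. ln (1 / P (z + of_real \<rho> * cis t))) - ln (1 / P z)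
        \<le> \<rho>\<^sup>2 / P z + 2 * (b \<rho>)\<^sup>2"
      by (simp add: field_simps)
    then have "4 / \<rho>\<^sup>2 * (1 / (2 * pi) * integral {0..2 * pi} (\<lambda>t. ln (1 / P (z + of_real \<rho> * cis t))) - ln (1 / P z))
        \<le> 4 / \<rho>\<^sup>2 * (\<rho>\<^sup>2 / P z + 2 * (b \<rho>)\<^sup>2)"
      by (intro mult_left_mono) auto
    also have "b \<rho> = \<rho> * ((2 * N + \<rho>) / P z)"
      by (simp add: b_def algebra_simps power2_eq_square)
    also have "4 / \<rho>\<^sup>2 * (\<rho>\<^sup>2 / P z + 2 * (\<rho> * ((2 * N + \<rho>) / P z))\<^sup>2) = 4 / P z + 8 * ((2 * N + \<rho>) / P z)\<^sup>2"
      using elim by (simp only: power_mult_distrib distrib_left) simp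
    finally show ?case .
  qed
  have "((\<lambda>\<rho>. 4 / P z + 8 * ((2 * N + \<rho>) / P z)\<^sup>2) \<longlongrightarrow> 4 / P z + 8 * ((2 * N + 0) / P z)\<^sup>2) (at_right 0)"
    using Pz by (intro tendsto_intros) auto
  then have lim: "((\<lambda>\<rho>. ereal (4 / P z + 8 * ((2 * N + \<rho>) / P z)\<^sup>2)) \<longlongrightarrow> ereal (4 / P z + 8 * ((2 * N + 0) / P z)\<^sup>2)) (at_right 0)"
    by (rule tendsto_ereal)
  have "lower_laplacian (\<lambda>w. ln (1 / P w)) z \<le> Liminf (at_right 0) (\<lambda>\<rho>. ereal (4 / P z + 8 * ((2 * N + \<rho>) / P z)\<^sup>2))"
    unfolding lower_laplacian_def by (rule Liminf_mono) (use ev in simp)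
  also have "\<dots> = ereal (4 / P z + 8 * ((2 * N + 0) / P z)\<^sup>2)"
    by (rule lim_imp_Liminf[OF _ lim]) simp
  also have "4 / P z + 8 * ((2 * N + 0) / P z)\<^sup>2 \<le> 36 * r\<^sup>2 / (P z)\<^sup>2"
  proof -
    have "N\<^sup>2 \<le> r\<^sup>2" using N by (intro power_mono) auto
    then have "4 * P z + 32 * N\<^sup>2 \<le> 36 * r\<^sup>2" using Pzr by linarith
    then have "(4 * P z + 32 * N\<^sup>2) / (P z)\<^sup>2 \<le> 36 * r\<^sup>2 / (P z)\<^sup>2"
      by (rule divide_right_mono) simp
    moreover have "4 / P z + 8 * ((2 * N + 0) / P z)\<^sup>2 = (4 * P z + 32 * N\<^sup>2) / (P z)\<^sup>2"
      using Pz by (simp add: field_simps power2_eq_square)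
    ultimately show ?thesis by simp
  qed
  finally show ?thesis by simp
qed

text \<open>
  Ahlfors' lemma up to the value of the constant: \<open>\<rho> * P\<close> vanishes on the boundary circle,
  so a positive maximum lies inside, where the hyperbolic density controls \<open>\<rho>\<close>.
\<close>

lemma sk_metric_bound:
  assumes sk: "sk_metric G \<rho>" and sub: "cball a r \<subseteq> G" and z: "z \<in> ball a r"
  shows "\<rho> z \<le> 6 * r / (r\<^sup>2 - (norm (z - a))\<^sup>2)"
proof -
  define P where "P = (\<lambda>w. r\<^sup>2 - (norm (w - a))\<^sup>2)"
  have r: "0 < r" using z by (metis ball_eq_empty empty_iff not_le)
  have P: "continuous_on S P" for S unfolding P_def by (intro continuous_intros)
  have Ppos: "0 < P w" if "w \<in> ball a r" for w
    using that by (simp add: P_def dist_norm norm_minus_commute power_strict_mono)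
  have \<rho>: "continuous_on (cball a r) \<rho>"
    using sk_metric_continuous[OF sk] sub by (rule continuous_on_subset)
  have "continuous_on (cball a r) (\<lambda>w. \<rho> w * P w)"
    by (intro continuous_on_mult \<rho> P)
  then obtain m where m: "m \<in> cball a r" "\<And>w. w \<in> cball a r \<Longrightarrow> \<rho> w * P w \<le> \<rho> m * P m"
    using continuous_attains_sup[OF compact_cball, of a r "\<lambda>w. \<rho> w * P w"] r by auto
  have "\<rho> m * P m \<le> 6 * r"
  proof (cases "m \<in> ball a r \<and> 0 < \<rho> m")
    case True
    have "ereal ((\<rho> m)\<^sup>2) \<le> lower_laplacian (\<lambda>w. ln (1 / P w)) m"
    proof (rule sk_metric_at_quotient_max[OF sk open_ball, where z = m])
      show "continuous_on (ball a r) (\<lambda>w. 1 / P w)"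
        using Ppos by (intro continuous_intros P) force
      show "\<rho> w / (1 / P w) \<le> \<rho> m / (1 / P m)" if "w \<in> ball a r" for w
        using m(2) that ball_subset_cball by auto
      show "ball a r \<subseteq> G" using sub ball_subset_cball by blast
    qed (use True Ppos in auto)
    also have "\<dots> \<le> ereal (36 * r\<^sup>2 / (P m)\<^sup>2)"
      unfolding P_def using True by (intro lower_laplacian_hyperbolic_le) auto
    finally have "(\<rho> m)\<^sup>2 \<le> 36 * r\<^sup>2 / (P m)\<^sup>2" by simp
    then have "(\<rho> m)\<^sup>2 * (P m)\<^sup>2 \<le> 36 * r\<^sup>2"
      using Ppos[of m] True by (simp add: pos_le_divide_eq)
    then have "(\<rho> m * P m)\<^sup>2 \<le> (6 * r)\<^sup>2"
      by (simp add: power_mult_distrib)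
    then show ?thesis by (rule power2_le_imp_le) (use r in simp)
  next
    case False
    then consider "m \<in> sphere a r" | "\<rho> m = 0"
      using m(1) sk_metric_nonneg[OF sk] sub by fastforce
    then show ?thesis
      using r by cases (auto simp: P_def dist_norm norm_minus_commute)
  qed
  then have "\<rho> z * P z \<le> 6 * r" using m(2)[of z] z by auto
  then have "\<rho> z \<le> 6 * r / P z" using Ppos[OF z] by (simp add: pos_le_divide_eq)
  then show ?thesis by (simp add: P_def)
qed

section \<open>Twice continuously differentiable functions of a complex variable\<close>

text \<open>
  The gradient is kept as the complex number \<open>g = s\<^sub>x - \<i> s\<^sub>y = 2 \<partial>s/\<partial>z\<close>, so that the
  differential of \<open>s\<close> is \<open>h \<longmapsto> Re (g * h)\<close> and the second derivative of \<open>s\<close> is the first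
  derivative \<open>G\<close> of \<open>g\<close>.
\<close>

definition has_C2_gradient ::
  "complex set \<Rightarrow> (complex \<Rightarrow> real) \<Rightarrow> (complex \<Rightarrow> complex) \<Rightarrow> (complex \<Rightarrow> complex \<Rightarrow>\<^sub>L complex) \<Rightarrow> bool"
where
  "has_C2_gradient S s g G \<longleftrightarrow>
     (\<forall>z\<in>S. (s has_derivative (\<lambda>h. Re (g z * h))) (at z)) \<and>
     (\<forall>z\<in>S. (g has_derivative blinfun_apply (G z)) (at z)) \<and>
     continuous_on S G"

text \<open>
  Twice the Wirtinger derivative with respect to the conjugate variable. If \<open>L\<close> is the
  derivative of the gradient of \<open>s\<close> in the above sense, this is the Laplacian of \<open>s\<close>.
\<close>

definition dbar :: "(complex \<Rightarrow>\<^sub>L complex) \<Rightarrow> complex" where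
  "dbar L = L 1 + \<i> * L \<i>"

lemma has_C2_gradientD:
  assumes "has_C2_gradient S s g G"
  shows "z \<in> S \<Longrightarrow> (s has_derivative (\<lambda>h. Re (g z * h))) (at z)"
    and "z \<in> S \<Longrightarrow> (g has_derivative blinfun_apply (G z)) (at z)"
    and "continuous_on S s" "continuous_on S g" "continuous_on S G"
  using assms unfolding has_C2_gradient_def
  by (auto intro!: continuous_at_imp_continuous_on has_derivative_continuous)

lemma has_C2_gradient_subset:
  "has_C2_gradient S s g G \<Longrightarrow> T \<subseteq> S \<Longrightarrow> has_C2_gradient T s g G"
  unfolding has_C2_gradient_def by (auto intro: continuous_on_subset)

lemma blinfun_complex_expand:
  "blinfun_apply (L :: complex \<Rightarrow>\<^sub>L 'a::real_normed_vector) h = Re h *\<^sub>R L 1 + Im h *\<^sub>R L \<i>"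
proof -
  have "h = Re h *\<^sub>R 1 + Im h *\<^sub>R \<i>" by (simp add: complex_eq_iff)
  then have "L h = L (Re h *\<^sub>R 1 + Im h *\<^sub>R \<i>)" by simp
  then show ?thesis by (simp add: blinfun.add_right blinfun.scaleR_right)
qed

lemma C2_on_iff_gradient: "C2_on S f \<longleftrightarrow> (\<exists>g G. has_C2_gradient S f g G)"
proof
  assume "C2_on S f"
  then obtain f' :: "complex \<Rightarrow> complex \<Rightarrow>\<^sub>L real" and f'' :: "complex \<Rightarrow> complex \<Rightarrow>\<^sub>L complex \<Rightarrow>\<^sub>L real"
    where f: "\<And>z. z \<in> S \<Longrightarrow> (f has_derivative blinfun_apply (f' z)) (at z)"
      "\<And>z. z \<in> S \<Longrightarrow> (f' has_derivative blinfun_apply (f'' z)) (at z)" "continuous_on S f''"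
    unfolding C2_on_def by blast
  define gr :: "(complex \<Rightarrow>\<^sub>L real) \<Rightarrow> complex" where "gr = (\<lambda>L. of_real (L 1) - \<i> * of_real (L \<i>))"
  have bl: "bounded_linear gr"
    unfolding gr_def
    by (intro bounded_linear_sub bounded_linear_const_mult
      bounded_linear_compose[OF bounded_linear_of_real] blinfun.bounded_linear_left)
  have gr: "Re (gr L * h) = L h" for L h
    by (simp add: gr_def blinfun_complex_expand[of L h])
  have "has_C2_gradient S f (\<lambda>z. gr (f' z)) (\<lambda>z. Blinfun gr o\<^sub>L f'' z)"
    unfolding has_C2_gradient_def
  proof (intro conjI ballI)
    fix z assume z: "z \<in> S"
    show "(f has_derivative (\<lambda>h. Re (gr (f' z) * h))) (at z)"
      using f(1)[OF z] by (simp only: gr)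
    show "((\<lambda>z. gr (f' z)) has_derivative blinfun_apply (Blinfun gr o\<^sub>L f'' z)) (at z)"
      using bounded_linear.has_derivative[OF bl f(2)[OF z]]
      by (rule has_derivative_eq_rhs) (simp add: fun_eq_iff bounded_linear_Blinfun_apply[OF bl])
  next
    show "continuous_on S (\<lambda>z. Blinfun gr o\<^sub>L f'' z)"
      by (intro continuous_intros f(3))
  qed
  then show "\<exists>g G. has_C2_gradient S f g G" by blast
next
  assume "\<exists>g G. has_C2_gradient S f g G"
  then obtain g G where gG: "has_C2_gradient S f g G" by blast
  define B :: "complex \<Rightarrow> complex \<Rightarrow>\<^sub>L real" where "B = (\<lambda>c. Blinfun Re o\<^sub>L blinfun_mult_right c)"
  have bl: "bounded_linear B"
    unfolding B_def
    by (intro bounded_linear_compose[OF bounded_bilinear.bounded_linear_right[OF bounded_bilinear_blinfun_compose]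
      bounded_linear_blinfun_mult_right])
  have B: "B c h = Re (c * h)" for c h
    by (simp add: B_def bounded_linear_Blinfun_apply[OF bounded_linear_Re])
  show "C2_on S f"
    unfolding C2_on_def
  proof (intro exI conjI ballI)
    fix z assume z: "z \<in> S"
    have "blinfun_apply (B (g z)) = (\<lambda>h. Re (g z * h))" by (simp add: B fun_eq_iff)
    then show "(f has_derivative blinfun_apply (B (g z))) (at z)"
      using has_C2_gradientD(1)[OF gG z] by simp
    show "((\<lambda>z. B (g z)) has_derivative blinfun_apply (Blinfun B o\<^sub>L G z)) (at z)"
      using bounded_linear.has_derivative[OF bl has_C2_gradientD(2)[OF gG z]]
      by (rule has_derivative_eq_rhs) (simp add: fun_eq_iff bounded_linear_Blinfun_apply[OF bl])
  next
    show "continuous_on S (\<lambda>z. Blinfun B o\<^sub>L G z)"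
      by (intro continuous_intros has_C2_gradientD(5)[OF gG])
  qed
qed

lemma has_C2_gradient_compose:
  assumes s: "has_C2_gradient S s g G"
    and \<phi>: "\<And>z. z \<in> S \<Longrightarrow> (\<phi> has_real_derivative \<phi>' (s z)) (at (s z))"
      "\<And>z. z \<in> S \<Longrightarrow> (\<phi>' has_real_derivative \<phi>'' (s z)) (at (s z))"
      "continuous_on S (\<lambda>z. \<phi>'' (s z))"
  shows "has_C2_gradient S (\<lambda>z. \<phi> (s z)) (\<lambda>z. \<phi>' (s z) *\<^sub>R g z)
    (\<lambda>z. \<phi>' (s z) *\<^sub>R G z + \<phi>'' (s z) *\<^sub>R (blinfun_mult_right (g z) o\<^sub>L Blinfun of_real o\<^sub>L Blinfun Re o\<^sub>L blinfun_mult_right (g z)))"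
  unfolding has_C2_gradient_def
proof (intro conjI ballI)
  fix z assume z: "z \<in> S"
  have ds: "(s has_derivative (\<lambda>h. Re (g z * h))) (at z)"
    and dg: "(g has_derivative blinfun_apply (G z)) (at z)"
    using has_C2_gradientD[OF s] z by auto
  have "((\<lambda>z. \<phi> (s z)) has_derivative (\<lambda>h. \<phi>' (s z) * Re (g z * h))) (at z)"
    using has_derivative_compose[OF ds \<phi>(1)[OF z, unfolded has_field_derivative_def]] by simp
  then show "((\<lambda>z. \<phi> (s z)) has_derivative (\<lambda>h. Re (\<phi>' (s z) *\<^sub>R g z * h))) (at z)"
    by (simp add: algebra_simps)
  have "((\<lambda>z. \<phi>' (s z)) has_derivative (\<lambda>h. \<phi>'' (s z) * Re (g z * h))) (at z)"
    using has_derivative_compose[OF ds \<phi>(2)[OF z, unfolded has_field_derivative_def]] by simp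
  from has_derivative_scaleR[OF this dg]
  show "((\<lambda>z. \<phi>' (s z) *\<^sub>R g z) has_derivative blinfun_apply (\<phi>' (s z) *\<^sub>R G z + \<phi>'' (s z) *\<^sub>R
      (blinfun_mult_right (g z) o\<^sub>L Blinfun of_real o\<^sub>L Blinfun Re o\<^sub>L blinfun_mult_right (g z)))) (at z)"
    by (rule has_derivative_eq_rhs)
       (simp add: fun_eq_iff blinfun.add_left blinfun.scaleR_left bounded_linear_Blinfun_apply
          bounded_linear_Re bounded_linear_of_real scaleR_conv_of_real mult_ac)
next
  have \<phi>': "continuous_on S (\<lambda>z. \<phi>' (s z))"
  proof (intro continuous_at_imp_continuous_on ballI)
    fix z assume z: "z \<in> S"
    show "isCont (\<lambda>z. \<phi>' (s z)) z"
      by (rule isCont_o2[OF has_derivative_continuous[OF has_C2_gradientD(1)[OF s z]] DERIV_isCont[OF \<phi>(2)[OF z]]])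
  qed
  have gm: "continuous_on S (\<lambda>z. blinfun_mult_right (g z))"
    by (rule bounded_linear.continuous_on[OF bounded_linear_blinfun_mult_right has_C2_gradientD(4)[OF s]])
  show "continuous_on S (\<lambda>z. \<phi>' (s z) *\<^sub>R G z + \<phi>'' (s z) *\<^sub>R
      (blinfun_mult_right (g z) o\<^sub>L Blinfun of_real o\<^sub>L Blinfun Re o\<^sub>L blinfun_mult_right (g z)))"
    by (intro continuous_intros \<phi>' \<phi>(3) gm has_C2_gradientD(5)[OF s])
qed

lemma C2_on_ln:
  assumes "C2_on S f" "\<And>z. z \<in> S \<Longrightarrow> 0 < f z"
  shows "C2_on S (\<lambda>z. ln (f z))"
proof -
  obtain g G where gG: "has_C2_gradient S f g G" using assms(1) C2_on_iff_gradient by blast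
  show ?thesis
    unfolding C2_on_iff_gradient
  proof (intro exI, rule has_C2_gradient_compose[OF gG])
    fix z assume z: "z \<in> S"
    note pos = assms(2)[OF z]
    show "(ln has_real_derivative inverse (f z)) (at (f z))"
      using pos by (rule DERIV_ln)
    show "(inverse has_real_derivative - (inverse (f z) ^ 2)) (at (f z))"
      using pos DERIV_inverse[of "f z" UNIV] by (simp add: numeral_2_eq_2)
  next
    show "continuous_on S (\<lambda>z. - (inverse (f z) ^ 2))"
      using assms(2) by (intro continuous_intros has_C2_gradientD(3)[OF gG]) force
  qed
qed

lemma has_C2_gradient_exp:
  fixes c :: real
  assumes "has_C2_gradient S s g G"
  shows "\<exists>E. has_C2_gradient S (\<lambda>z. exp (c * s z)) (\<lambda>z. (c * exp (c * s z)) *\<^sub>R g z) E"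
  by (intro exI, rule has_C2_gradient_compose[OF assms, where \<phi> = "\<lambda>x. exp (c * x)"
        and \<phi>' = "\<lambda>x. c * exp (c * x)" and \<phi>'' = "\<lambda>x. c * (c * exp (c * x))"])
     (auto intro!: derivative_eq_intros continuous_intros has_C2_gradientD(3)[OF assms])

section \<open>Circle integrals\<close>

lemma circle_radial_derivative:
  assumes "(f has_derivative f') (at (z + of_real t * cis \<theta>))"
  shows "((\<lambda>t. f (z + of_real t * cis \<theta>)) has_vector_derivative f' (cis \<theta>)) (at t within T)"
proof -
  interpret bounded_linear f' using assms by (rule has_derivative_bounded_linear)
  have "((\<lambda>t. z + of_real t * cis \<theta>) has_derivative (\<lambda>h. h *\<^sub>R cis \<theta>)) (at t within T)"
    by (auto intro!: derivative_eq_intros simp: scaleR_conv_of_real)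
  from has_derivative_compose[OF this assms] show ?thesis
    by (simp add: has_vector_derivative_def scaleR)
qed

lemma circle_angular_derivative:
  assumes "(f has_derivative f') (at (z + of_real t * cis \<theta>))"
  shows "((\<lambda>\<theta>. f (z + of_real t * cis \<theta>)) has_vector_derivative f' (of_real t * (\<i> * cis \<theta>))) (at \<theta> within T)"
proof -
  interpret bounded_linear f' using assms by (rule has_derivative_bounded_linear)
  have "((\<lambda>\<theta>. z + of_real t * cis \<theta>) has_derivative (\<lambda>h. h *\<^sub>R (of_real t * (\<i> * cis \<theta>)))) (at \<theta> within T)"
    by (auto intro!: derivative_eq_intros has_derivative_cis simp: scaleR_conv_of_real algebra_simps)
  from has_derivative_compose[OF this assms] show ?thesis
    by (simp add: has_vector_derivative_def scaleR)
qed

lemma circle_second_moment: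
  fixes L :: "complex \<Rightarrow>\<^sub>L complex"
  shows "((\<lambda>\<theta>. L (cis \<theta>) * cis \<theta>) has_integral of_real pi * dbar L) {0..2*pi}"
proof -
  define A where "A = (\<lambda>\<theta>. L 1 * (of_real (\<theta> / 2) - \<i> * cis (2 * \<theta>) / 4)
    + L \<i> * (\<i> * of_real (\<theta> / 2) - cis (2 * \<theta>) / 4))"
  have "((\<lambda>\<theta>. L (cis \<theta>) * cis \<theta>) has_integral (A (2 * pi) - A 0)) {0..2*pi}"
  proof (rule fundamental_theorem_of_calculus)
    fix \<theta> :: real
    have d: "(A has_vector_derivative L 1 * (1 / 2 + cis (2 * \<theta>) / 2)
        + L \<i> * (\<i> / 2 - \<i> * cis (2 * \<theta>) / 2)) (at \<theta> within {0..2*pi})"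
      unfolding A_def has_vector_derivative_def
      by (auto intro!: derivative_eq_intros has_derivative_cis simp: scaleR_conv_of_real algebra_simps fun_eq_iff)
    have c: "cos \<theta> * cis \<theta> = 1 / 2 + cis (2 * \<theta>) / 2" "sin \<theta> * cis \<theta> = \<i> / 2 - \<i> * cis (2 * \<theta>) / 2"
      using cos_double_cos[of \<theta>] cos_double_sin[of \<theta>] sin_double[of \<theta>]
      by (auto simp: complex_eq_iff power2_eq_square field_simps)
    show "(A has_vector_derivative L (cis \<theta>) * cis \<theta>) (at \<theta> within {0..2*pi})"
      using d unfolding c[symmetric]
      by (simp add: blinfun_complex_expand[of L "cis \<theta>"] scaleR_conv_of_real algebra_simps)
  qed simp
  moreover have "cis (2 * (2 * pi)) = 1"
    using cis_multiple_2pi[of 2] by (simp add: mult_ac)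
  ultimately show ?thesis
    by (simp add: A_def dbar_def algebra_simps)
qed

text \<open>
  The flux of a gradient through a small circle is, to leading order, the divergence times the
  area of the disk; this yields both the symmetry of the second derivative and the value of
  the lower Laplacian.
\<close>

lemma circle_flux_asymptotics:
  fixes L :: "complex \<Rightarrow>\<^sub>L complex"
  assumes U: "open U" "z \<in> U" "continuous_on U g" and d: "(g has_derivative blinfun_apply L) (at z)"
  shows "((\<lambda>t. integral {0..2*pi} (\<lambda>\<theta>. g (z + of_real t * cis \<theta>) * cis \<theta>) / of_real t)
    \<longlongrightarrow> of_real pi * dbar L) (at_right 0)"
proof (rule tendstoI)
  fix e :: real assume "e > 0"
  define e' where "e' = e / (4 * pi)"
  have e': "e' > 0" using \<open>e > 0\<close> by (simp add: e'_def)
  obtain \<delta>1 where \<delta>1: "\<delta>1 > 0" "ball z \<delta>1 \<subseteq> U" using U openE by blast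
  obtain \<delta>2 where \<delta>2: "\<delta>2 > 0" "\<And>w. norm (w - z) < \<delta>2 \<Longrightarrow> norm (g w - g z - L (w - z)) \<le> e' * norm (w - z)"
    using d e' unfolding has_derivative_at_alt by blast
  have "\<forall>\<^sub>F t in at_right (0::real). 0 < t \<and> t < min \<delta>1 \<delta>2"
    using \<delta>1(1) \<delta>2(1) by (intro eventually_at_right_0_less) simp
  then show "\<forall>\<^sub>F t in at_right 0. dist (integral {0..2*pi} (\<lambda>\<theta>. g (z + of_real t * cis \<theta>) * cis \<theta>) / of_real t)
      (of_real pi * dbar L) < e"
  proof eventually_elim
    case (elim t)
    have inU: "z + of_real t * cis \<theta> \<in> U" for \<theta>
      using circle_point_in_ball[of t \<delta>1 z \<theta>] elim \<delta>1 by auto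
    have "continuous_on {0..2*pi} (\<lambda>\<theta>. g (z + of_real t * cis \<theta>))"
      by (rule continuous_on_compose2[OF U(3)]) (use inU in \<open>auto intro!: continuous_intros\<close>)
    then have "(\<lambda>\<theta>. g (z + of_real t * cis \<theta>) * cis \<theta>) integrable_on {0..2*pi}"
      by (intro integrable_continuous_real continuous_intros)
    then have I1: "((\<lambda>\<theta>. g (z + of_real t * cis \<theta>) * cis \<theta>) has_integral
        integral {0..2*pi} (\<lambda>\<theta>. g (z + of_real t * cis \<theta>) * cis \<theta>)) {0..2*pi}"
      by (rule integrable_integral)
    have "cis integrable_on {0..2*pi}"
      by (intro integrable_continuous_real continuous_on_cis continuous_on_id)
    then have "(cis has_integral 0) {0..2*pi}"
      using integral_cis by (simp add: has_integral_iff)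
    from has_integral_mult_right[OF this, of "g z"]
    have I2: "((\<lambda>\<theta>. g z * cis \<theta>) has_integral 0) {0..2*pi}" by simp
    have I3: "((\<lambda>\<theta>. of_real t * (L (cis \<theta>) * cis \<theta>)) has_integral of_real t * (of_real pi * dbar L)) {0..2*pi}"
      by (rule has_integral_mult_right[OF circle_second_moment])
    have "((\<lambda>\<theta>. (g (z + of_real t * cis \<theta>) * cis \<theta> - g z * cis \<theta>) - of_real t * (L (cis \<theta>) * cis \<theta>)) has_integral
       (integral {0..2*pi} (\<lambda>\<theta>. g (z + of_real t * cis \<theta>) * cis \<theta>) - 0) - of_real t * (of_real pi * dbar L)) {0..2*pi}"
      by (intro has_integral_diff I1 I2 I3)
    then have "norm ((integral {0..2*pi} (\<lambda>\<theta>. g (z + of_real t * cis \<theta>) * cis \<theta>) - 0) - of_real t * (of_real pi * dbar L))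
       \<le> (e' * t) * measure lborel {0..2*pi}"
    proof (rule has_integral_bound_real[where S = "{}", rotated 2])
      show "0 \<le> e' * t" using e' elim by simp
      fix \<theta> :: real
      have Lt: "L (of_real t * cis \<theta>) = of_real t * L (cis \<theta>)"
        by (metis blinfun.scaleR_right scaleR_conv_of_real)
      have "norm (g (z + of_real t * cis \<theta>) - g z - L (of_real t * cis \<theta>)) \<le> e' * t"
        using \<delta>2(2)[of "z + of_real t * cis \<theta>"] elim by (simp add: norm_mult)
      then have "norm ((g (z + of_real t * cis \<theta>) - g z - L (of_real t * cis \<theta>)) * cis \<theta>) \<le> e' * t"
        by (simp add: norm_mult)
      moreover have "(g (z + of_real t * cis \<theta>) - g z - L (of_real t * cis \<theta>)) * cis \<theta>
          = g (z + of_real t * cis \<theta>) * cis \<theta> - g z * cis \<theta> - of_real t * (L (cis \<theta>) * cis \<theta>)"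
        unfolding Lt by (simp add: algebra_simps)
      ultimately show "norm (g (z + of_real t * cis \<theta>) * cis \<theta> - g z * cis \<theta> - of_real t * (L (cis \<theta>) * cis \<theta>)) \<le> e' * t"
        by (simp only:)
    qed simp
    then have *: "norm (integral {0..2*pi} (\<lambda>\<theta>. g (z + of_real t * cis \<theta>) * cis \<theta>) - of_real t * (of_real pi * dbar L))
       \<le> e' * t * (2 * pi)" by simp
    have "integral {0..2*pi} (\<lambda>\<theta>. g (z + of_real t * cis \<theta>) * cis \<theta>) / of_real t - of_real pi * dbar L
      = (integral {0..2*pi} (\<lambda>\<theta>. g (z + of_real t * cis \<theta>) * cis \<theta>) - of_real t * (of_real pi * dbar L)) / of_real t"
      using elim by (simp add: diff_divide_distrib)
    then have "dist (integral {0..2*pi} (\<lambda>\<theta>. g (z + of_real t * cis \<theta>) * cis \<theta>) / of_real t) (of_real pi * dbar L)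
      \<le> e' * t * (2 * pi) / t"
      using * elim by (simp add: dist_norm norm_divide pos_divide_le_eq mult_ac)
    also have "\<dots> < e" using elim \<open>e > 0\<close> by (simp add: e'_def)
    finally show ?case .
  qed
qed

text \<open>
  Symmetry of the second derivative. The imaginary part of the flux integral is a
  tangential derivative of \<open>s\<close> integrated around a closed circle, hence zero for every
  radius.
\<close>

lemma Im_dbar_eq_0:
  assumes C2: "has_C2_gradient S s g G" and S: "open S" "z \<in> S"
  shows "Im (dbar (G z)) = 0"
proof -
  obtain \<delta> where \<delta>: "\<delta> > 0" "ball z \<delta> \<subseteq> S" using S openE by blast
  let ?J = "\<lambda>t. integral {0..2*pi} (\<lambda>\<theta>. g (z + of_real t * cis \<theta>) * cis \<theta>)"
  have "((\<lambda>t. ?J t / of_real t) \<longlongrightarrow> of_real pi * dbar (G z)) (at_right 0)"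
    by (rule circle_flux_asymptotics[OF S has_C2_gradientD(4)[OF C2] has_C2_gradientD(2)[OF C2 S(2)]])
  then have "((\<lambda>t. Im (?J t / of_real t)) \<longlongrightarrow> Im (of_real pi * dbar (G z))) (at_right 0)"
    by (rule tendsto_Im)
  moreover have "\<forall>\<^sub>F t in at_right (0::real). 0 < t \<and> t < \<delta>"
    using \<delta>(1) by (rule eventually_at_right_0_less)
  then have "\<forall>\<^sub>F t in at_right 0. Im (?J t / of_real t) = 0"
  proof eventually_elim
    case (elim t)
    have inS: "z + of_real t * cis \<theta> \<in> S" for \<theta>
      using circle_point_in_ball[of t \<delta> z \<theta>] elim \<delta> by auto
    have "continuous_on {0..2*pi} (\<lambda>\<theta>. g (z + of_real t * cis \<theta>))"
      by (rule continuous_on_compose2[OF has_C2_gradientD(4)[OF C2]]) (use inS in \<open>auto intro!: continuous_intros\<close>)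
    then have "(\<lambda>\<theta>. g (z + of_real t * cis \<theta>) * cis \<theta>) integrable_on {0..2*pi}"
      by (intro integrable_continuous_real continuous_intros)
    then have "((\<lambda>\<theta>. g (z + of_real t * cis \<theta>) * cis \<theta>) has_integral ?J t) {0..2*pi}"
      by (rule integrable_integral)
    from has_integral_linear[OF this bounded_linear_Im]
    have 1: "((\<lambda>\<theta>. Im (g (z + of_real t * cis \<theta>) * cis \<theta>)) has_integral Im (?J t)) {0..2*pi}"
      by (simp add: o_def)
    have "((\<lambda>\<theta>. Re (g (z + of_real t * cis \<theta>) * (of_real t * (\<i> * cis \<theta>)))) has_integral
       s (z + of_real t * cis (2 * pi)) - s (z + of_real t * cis 0)) {0..2*pi}"
      by (intro fundamental_theorem_of_calculus circle_angular_derivative has_C2_gradientD(1)[OF C2 inS]) simp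
    moreover have "Re (g (z + of_real t * cis \<theta>) * (of_real t * (\<i> * cis \<theta>)))
        = - t * Im (g (z + of_real t * cis \<theta>) * cis \<theta>)" for \<theta>
      by (simp add: algebra_simps)
    ultimately have 2: "((\<lambda>\<theta>. - t * Im (g (z + of_real t * cis \<theta>) * cis \<theta>)) has_integral 0) {0..2*pi}"
      by (simp del: times_complex.sel)
    have "0 = - t * Im (?J t)"
      by (rule has_integral_unique[OF 2 has_integral_mult_right[OF 1]])
    then show ?case using elim by (simp add: Im_divide_of_real)
  qed
  then have "((\<lambda>t. Im (?J t / of_real t)) \<longlongrightarrow> 0) (at_right 0)"
    by (rule tendsto_eventually)
  ultimately have "Im (of_real pi * dbar (G z)) = 0"
    using tendsto_unique[OF trivial_limit_at_right_real] by blast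
  then show ?thesis by simp
qed

text \<open>
  The radial derivative of the circle mean is the real part of the flux integral divided by
  \<open>2 * pi\<close>, so l'Hopital's rule reduces the claim to the asymptotics of the flux.
\<close>

lemma lower_laplacian_C2:
  assumes C2: "has_C2_gradient S s g G" and S: "open S" "z \<in> S"
  shows "lower_laplacian s z = ereal (Re (dbar (G z)))"
proof -
  obtain \<delta> where \<delta>: "\<delta> > 0" "ball z \<delta> \<subseteq> S" using S openE by blast
  have inS: "z + of_real t * cis \<theta> \<in> S" if "t \<in> {-\<delta><..<\<delta>}" for t \<theta>
  proof -
    have "z + of_real t * cis \<theta> \<in> ball z \<delta>" using that by (auto simp: dist_norm norm_mult)
    then show ?thesis using \<delta> by blast
  qed
  let ?J = "\<lambda>t. integral {0..2*pi} (\<lambda>\<theta>. g (z + of_real t * cis \<theta>) * cis \<theta>)"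
  let ?m = "\<lambda>t. 1 / (2 * pi) * integral {0..2*pi} (\<lambda>\<theta>. s (z + of_real t * cis \<theta>)) - s z"
  have circ: "continuous_on ({-\<delta><..<\<delta>} \<times> cbox 0 (2*pi)) (\<lambda>(t, \<theta>). f (z + of_real t * cis \<theta>))"
    if "continuous_on S f" for f :: "complex \<Rightarrow> 'c::banach"
    unfolding split_def
    by (rule continuous_on_compose2[OF that]) (use inS in \<open>auto intro!: continuous_intros\<close>)
  have dm: "(?m has_real_derivative 1 / (2 * pi) * Re (?J t)) (at t)" if t: "t \<in> {-\<delta><..<\<delta>}" for t
  proof -
    have "((\<lambda>t. integral (cbox 0 (2*pi)) (\<lambda>\<theta>. s (z + of_real t * cis \<theta>))) has_vector_derivative
        integral (cbox 0 (2*pi)) (\<lambda>\<theta>. Re (g (z + of_real t * cis \<theta>) * cis \<theta>))) (at t within {-\<delta><..<\<delta>})"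
    proof (rule leibniz_rule_vector_derivative[OF _ _ _ t])
      fix t \<theta> assume t: "t \<in> {-\<delta><..<\<delta>}"
      show "((\<lambda>t. s (z + of_real t * cis \<theta>)) has_vector_derivative Re (g (z + of_real t * cis \<theta>) * cis \<theta>))
          (at t within {-\<delta><..<\<delta>})"
        by (rule circle_radial_derivative[OF has_C2_gradientD(1)[OF C2 inS[OF t]]])
      show "(\<lambda>\<theta>. s (z + of_real t * cis \<theta>)) integrable_on cbox 0 (2 * pi)"
        using circle_integrable[OF has_C2_gradientD(3)[OF C2] inS[OF t]] by simp
    next
      have "continuous_on ({-\<delta><..<\<delta>} \<times> cbox 0 (2*pi)) (\<lambda>p. g (z + of_real (fst p) * cis (snd p)))"
        using circ[OF has_C2_gradientD(4)[OF C2]] by (simp add: split_def)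
      then show "continuous_on ({-\<delta><..<\<delta>} \<times> cbox 0 (2*pi)) (\<lambda>(t, \<theta>). Re (g (z + of_real t * cis \<theta>) * cis \<theta>))"
        unfolding split_def by (intro continuous_intros)
    qed (rule convex_real_interval)
    moreover have "integral (cbox 0 (2*pi)) (\<lambda>\<theta>. Re (g (z + of_real t * cis \<theta>) * cis \<theta>)) = Re (?J t)"
    proof -
      have "continuous_on {0..2*pi} (\<lambda>\<theta>. g (z + of_real t * cis \<theta>))"
        by (rule continuous_on_compose2[OF has_C2_gradientD(4)[OF C2]])
           (use inS[OF t] in \<open>auto intro!: continuous_intros\<close>)
      then have "(\<lambda>\<theta>. g (z + of_real t * cis \<theta>) * cis \<theta>) integrable_on {0..2*pi}"
        by (intro integrable_continuous_real continuous_intros)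
      from integral_linear[OF this bounded_linear_Re] show ?thesis by (simp add: o_def)
    qed
    ultimately have "((\<lambda>t. integral {0..2*pi} (\<lambda>\<theta>. s (z + of_real t * cis \<theta>))) has_real_derivative Re (?J t)) (at t)"
      using t by (simp add: has_real_derivative_iff_has_vector_derivative at_within_open[of t "{-\<delta><..<\<delta>}"])
    then show ?thesis by (auto intro!: derivative_eq_intros)
  qed
  have ev: "\<forall>\<^sub>F t in at_right (0::real). 0 < t \<and> t < \<delta>"
    using \<delta>(1) by (rule eventually_at_right_0_less)
  have "((\<lambda>t. ?m t / (t\<^sup>2 / 4)) \<longlongrightarrow> Re (dbar (G z))) (at_right 0)"
  proof (rule lhopital_right_0[where f' = "\<lambda>t. 1 / (2 * pi) * Re (?J t)" and g' = "\<lambda>t. t / 2"])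
    have "isCont ?m 0" using dm[of 0] \<delta> by (intro DERIV_isCont) auto
    moreover have "?m 0 = 0" by simp
    ultimately show "(?m \<longlongrightarrow> 0) (at_right 0)"
      unfolding isCont_def by (simp only: filterlim_at_split)
    have "((\<lambda>t::real. t\<^sup>2 / 4) \<longlongrightarrow> 0\<^sup>2 / 4) (at_right 0)" by (intro tendsto_intros) auto
    then show "((\<lambda>t::real. t\<^sup>2 / 4) \<longlongrightarrow> 0) (at_right 0)" by simp
    show "\<forall>\<^sub>F t in at_right (0::real). t\<^sup>2 / 4 \<noteq> 0" "\<forall>\<^sub>F t in at_right (0::real). t / 2 \<noteq> 0"
      by (use ev in \<open>auto elim!: eventually_mono\<close>)
    show "\<forall>\<^sub>F t in at_right 0. (?m has_real_derivative 1 / (2 * pi) * Re (?J t)) (at t)"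
      using ev by eventually_elim (rule dm, use \<delta> in auto)
    show "\<forall>\<^sub>F t in at_right (0::real). ((\<lambda>t. t\<^sup>2 / 4) has_real_derivative t / 2) (at t)"
      by (intro always_eventually allI) (auto intro!: derivative_eq_intros)
    have "((\<lambda>t. Re (?J t / of_real t)) \<longlongrightarrow> Re (of_real pi * dbar (G z))) (at_right 0)"
      by (intro tendsto_Re circle_flux_asymptotics[OF S has_C2_gradientD(4)[OF C2] has_C2_gradientD(2)[OF C2 S(2)]])
    then have "((\<lambda>t. 1 / pi * Re (?J t / of_real t)) \<longlongrightarrow> 1 / pi * Re (of_real pi * dbar (G z))) (at_right 0)"
      by (rule tendsto_mult_left)
    moreover have "1 / pi * Re (?J t / of_real t) = 1 / (2 * pi) * Re (?J t) / (t / 2)" for t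
      by (simp add: Re_divide_of_real)
    moreover have "1 / pi * Re (of_real pi * dbar (G z)) = Re (dbar (G z))" by simp
    ultimately show "((\<lambda>t. 1 / (2 * pi) * Re (?J t) / (t / 2)) \<longlongrightarrow> Re (dbar (G z))) (at_right 0)"
      by (simp only:)
  qed
  then have "((\<lambda>t. ereal (4 / t\<^sup>2 * ?m t)) \<longlongrightarrow> ereal (Re (dbar (G z)))) (at_right 0)"
    by (intro tendsto_ereal) (simp add: mult.commute)
  then show ?thesis
    unfolding lower_laplacian_def by (intro lim_imp_Liminf) auto
qed

section \<open>Representing the gradient by the function and its Laplacian\<close>

lemma dbar_rotated:
  fixes L :: "complex \<Rightarrow>\<^sub>L complex"
  shows "L (cis \<theta>) + \<i> * L (\<i> * cis \<theta>) = cis (- \<theta>) * dbar L"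
proof -
  have c: "cis (- \<theta>) = of_real (cos \<theta>) - \<i> * of_real (sin \<theta>)"
    by (simp add: complex_eq_iff)
  show ?thesis
    unfolding c dbar_def blinfun_complex_expand[of L "cis \<theta>"] blinfun_complex_expand[of L "\<i> * cis \<theta>"]
    by (simp add: scaleR_conv_of_real algebra_simps)
qed

lemma circle_map_continuous:
  fixes f :: "complex \<Rightarrow> 'c::topological_space"
  assumes "continuous_on S f" "cball z \<rho> \<subseteq> S" "T \<subseteq> {0..\<rho>}"
  shows "continuous_on (T \<times> X) (\<lambda>p. f (z + of_real (fst p) * cis (snd p)))"
proof (rule continuous_on_compose2[OF assms(1)])
  show "continuous_on (T \<times> X) (\<lambda>p. z + of_real (fst p) * cis (snd p))"
    by (intro continuous_intros)
  have "z + of_real t * cis \<theta> \<in> cball z \<rho>" if "t \<in> T" for t \<theta>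
    using that assms(3) by (auto simp: dist_norm norm_mult)
  then show "(\<lambda>p. z + of_real (fst p) * cis (snd p)) ` (T \<times> X) \<subseteq> S"
    using assms(2) by auto
qed

text \<open>
  The two terms of a representation formula of Cauchy-Pompeiu type,
  \<open>\<nabla>s (z) = circle_part \<rho> s z - disk_part \<rho> (\<Delta>s) z\<close>, written in polar coordinates about \<open>z\<close>. The
  Jacobian of the polar coordinates cancels the singularity of the kernel, so both are
  integrals of translates of the function against a bounded continuous weight. The factor
  \<open>1 - t\<^sup>2 / \<rho>\<^sup>2\<close> is what allows the boundary term to contain \<open>s\<close> instead of its gradient.
\<close>

definition circle_part :: "real \<Rightarrow> (complex \<Rightarrow> real) \<Rightarrow> complex \<Rightarrow> complex" where
  "circle_part \<rho> f z =
     integral (cbox 0 (2 * pi)) (\<lambda>\<theta>. f (z + of_real \<rho> * cis \<theta>) *\<^sub>R (cis (- \<theta>) / of_real (pi * \<rho>)))"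

definition disk_part :: "real \<Rightarrow> (complex \<Rightarrow> real) \<Rightarrow> complex \<Rightarrow> complex" where
  "disk_part \<rho> f z =
     integral (cbox (0, 0) (\<rho>, 2 * pi))
       (\<lambda>p. f (z + of_real (fst p) * cis (snd p)) *\<^sub>R
              (of_real (1 - (fst p)\<^sup>2 / \<rho>\<^sup>2) * cis (- snd p) / of_real (2 * pi)))"

text \<open>
  Put \<open>Q t = (1 - t\<^sup>2/\<rho>\<^sup>2) * \<integral> g + (2*t/\<rho>\<^sup>2) * \<integral> cis (-\<theta>) * s\<close>, where the integrals are
  taken in \<open>\<theta>\<close> around the circle of radius \<open>t\<close> about \<open>z\<close>. Then \<open>Q 0\<close> is \<open>2 * pi * g z\<close>, \<open>Q \<rho>\<close> is
  \<open>2 * pi\<close> times the circle part, and in \<open>Q'\<close> everything except the Laplacian is a derivative in the angle \<open>\<theta>\<close> and integrates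
  to zero. The fundamental theorem of calculus on \<open>[0, \<rho>]\<close> gives the formula.
\<close>

lemma gradient_representation:
  assumes C2: "has_C2_gradient S s g G" and S: "open S" "cball z \<rho> \<subseteq> S" and \<rho>: "0 < \<rho>"
    and F: "\<And>w. w \<in> S \<Longrightarrow> Re (dbar (G w)) = F w" and contF: "continuous_on S F"
  shows "g z = circle_part \<rho> s z - disk_part \<rho> F z"
proof -
  note D = has_C2_gradientD[OF C2]
  define w where "w = (\<lambda>t \<theta>. z + of_real t * cis \<theta>)"
  have wS: "w t \<theta> \<in> S" if "t \<in> {0..\<rho>}" for t \<theta>
  proof -
    have "w t \<theta> \<in> cball z \<rho>" using that by (auto simp: w_def dist_norm norm_mult)
    then show ?thesis using S by blast
  qed
  define \<alpha> where "\<alpha> = (\<lambda>t::real. of_real (1 - t\<^sup>2 / \<rho>\<^sup>2) :: complex)"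
  define \<beta> where "\<beta> = (\<lambda>t::real. of_real (2 * t / \<rho>\<^sup>2) :: complex)"
  define q where "q = (\<lambda>t \<theta>. \<alpha> t * g (w t \<theta>) + \<beta> t * (cis (- \<theta>) * of_real (s (w t \<theta>))))"
  define q' where "q' = (\<lambda>t \<theta>. (\<alpha> t * G (w t \<theta>) (cis \<theta>) - \<beta> t * g (w t \<theta>))
     + (\<beta> t * (cis (- \<theta>) * of_real (Re (g (w t \<theta>) * cis \<theta>))) + \<beta> 1 * (cis (- \<theta>) * of_real (s (w t \<theta>)))))"
  define Q where "Q = (\<lambda>t. integral (cbox 0 (2*pi)) (q t))"
  have cg: "continuous_on ({0..\<rho>} \<times> X) (\<lambda>p. g (w (fst p) (snd p)))"
    and cs: "continuous_on ({0..\<rho>} \<times> X) (\<lambda>p. s (w (fst p) (snd p)))"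
    and cF: "continuous_on ({0..\<rho>} \<times> X) (\<lambda>p. F (w (fst p) (snd p)))"
    and cG: "continuous_on ({0..\<rho>} \<times> X) (\<lambda>p. G (w (fst p) (snd p)))" for X
    unfolding w_def by (rule circle_map_continuous[OF _ S(2) order_refl], rule D contF)+
  have cq: "continuous_on ({0..\<rho>} \<times> cbox 0 (2*pi)) (\<lambda>(t, \<theta>). q t \<theta>)"
    unfolding q_def \<alpha>_def \<beta>_def split_def using \<rho> by (intro continuous_intros cg cs) auto
  have cq': "continuous_on ({0..\<rho>} \<times> cbox 0 (2*pi)) (\<lambda>(t, \<theta>). q' t \<theta>)"
    unfolding q'_def \<alpha>_def \<beta>_def split_def using \<rho> by (intro continuous_intros cg cs cG) auto
  have cQ: "continuous_on {0..\<rho>} Q"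
    unfolding Q_def by (rule integral_continuous_on_param[OF cq])
  have dQ: "(Q has_vector_derivative integral (cbox 0 (2*pi)) (q' t)) (at t)" if t: "t \<in> {0<..<\<rho>}" for t
  proof -
    have "(Q has_vector_derivative integral (cbox 0 (2*pi)) (q' t)) (at t within {0<..<\<rho>})"
      unfolding Q_def
    proof (rule leibniz_rule_vector_derivative[OF _ _ _ t])
      fix t \<theta> :: real assume t: "t \<in> {0<..<\<rho>}"
      then have wt: "w t \<theta> \<in> S" using wS by simp
      have d1: "((\<lambda>t. g (w t \<theta>)) has_vector_derivative G (w t \<theta>) (cis \<theta>)) (at t within {0<..<\<rho>})"
        using circle_radial_derivative D(2) wt unfolding w_def by blast
      have "((\<lambda>t. s (w t \<theta>)) has_vector_derivative Re (g (w t \<theta>) * cis \<theta>)) (at t within {0<..<\<rho>})"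
        using circle_radial_derivative[OF D(1)] wt unfolding w_def by blast
      then have d2: "((\<lambda>t. complex_of_real (s (w t \<theta>))) has_vector_derivative of_real (Re (g (w t \<theta>) * cis \<theta>))) (at t within {0<..<\<rho>})"
        by (rule bounded_linear.has_vector_derivative[OF bounded_linear_of_real])
      have d3: "(\<alpha> has_vector_derivative - \<beta> t) (at t within {0<..<\<rho>})"
      proof -
        define c where "c = 1 / \<rho>\<^sup>2"
        have "((\<lambda>t. 1 - c * t\<^sup>2) has_real_derivative - (2 * t * c)) (at t within {0<..<\<rho>})"
          by (auto intro!: derivative_eq_intros)
        then have "((\<lambda>t. of_real (1 - c * t\<^sup>2)) has_vector_derivative complex_of_real (- (2 * t * c))) (at t within {0<..<\<rho>})"
          by (rule has_vector_derivative_of_real)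
        then show ?thesis by (simp add: \<alpha>_def \<beta>_def c_def)
      qed
      have d4: "(\<beta> has_vector_derivative \<beta> 1) (at t within {0<..<\<rho>})"
      proof -
        define c where "c = 2 / \<rho>\<^sup>2"
        have "((\<lambda>t. c * t) has_real_derivative c) (at t within {0<..<\<rho>})"
          by (auto intro!: derivative_eq_intros)
        then have "((\<lambda>t. of_real (c * t)) has_vector_derivative complex_of_real c) (at t within {0<..<\<rho>})"
          by (rule has_vector_derivative_of_real)
        then show ?thesis by (simp add: \<beta>_def c_def)
      qed
      show "((\<lambda>t. q t \<theta>) has_vector_derivative q' t \<theta>) (at t within {0<..<\<rho>})"
        unfolding q_def
        by (rule has_vector_derivative_eq_rhs[OF has_vector_derivative_add[OF has_vector_derivative_mult[OF d3 d1]
              has_vector_derivative_mult[OF d4 has_vector_derivative_mult_right[OF d2]]]])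
           (simp add: q'_def)
    next
      fix t assume t: "t \<in> {0<..<\<rho>}"
      show "q t integrable_on cbox 0 (2 * pi)"
      proof (rule integrable_continuous)
        have "continuous_on (cbox 0 (2*pi)) ((\<lambda>(t, \<theta>). q t \<theta>) \<circ> (\<lambda>\<theta>. (t, \<theta>)))"
          by (rule continuous_on_compose[OF _ continuous_on_subset[OF cq]]) (use t in \<open>auto intro!: continuous_intros\<close>)
        then show "continuous_on (cbox 0 (2*pi)) (q t)" by (simp add: o_def)
      qed
    next
      show "continuous_on ({0<..<\<rho>} \<times> cbox 0 (2 * pi)) (\<lambda>(t, \<theta>). q' t \<theta>)"
        by (rule continuous_on_subset[OF cq']) auto
    qed (rule convex_real_interval)
    then show ?thesis using t by (simp add: at_within_open[of t "{0<..<\<rho>}"])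
  qed
  \<comment> \<open>Up to a total \<open>\<theta>\<close>-derivative, only the Laplacian is left in \<open>Q'\<close>.\<close>
  define h where "h = (\<lambda>t. integral (cbox 0 (2*pi)) (\<lambda>\<theta>. \<alpha> t * (cis (- \<theta>) * of_real (F (w t \<theta>)))))"
  have int_q': "integral (cbox 0 (2*pi)) (q' t) = h t" if t: "t \<in> {0<..<\<rho>}" for t
  proof -
    define A where "A = (\<lambda>\<theta>. - (\<alpha> t * \<i> / of_real t) * g (w t \<theta>) + \<beta> 1 * (\<i> * (cis (- \<theta>) * of_real (s (w t \<theta>)))))"
    have dA: "(A has_vector_derivative q' t \<theta> - \<alpha> t * (cis (- \<theta>) * of_real (F (w t \<theta>)))) (at \<theta> within {0..2*pi})" for \<theta>
    proof -
      have wt: "w t \<theta> \<in> S" using wS t by simp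
      define v where "v = g (w t \<theta>) * cis \<theta>"
      have "((\<lambda>\<theta>. g (w t \<theta>)) has_vector_derivative G (w t \<theta>) (of_real t * (\<i> * cis \<theta>))) (at \<theta> within {0..2*pi})"
        using circle_angular_derivative D(2) wt unfolding w_def by blast
      moreover have "G (w t \<theta>) (of_real t * (\<i> * cis \<theta>)) = of_real t * G (w t \<theta>) (\<i> * cis \<theta>)"
        by (metis blinfun.scaleR_right scaleR_conv_of_real)
      ultimately have d1: "((\<lambda>\<theta>. g (w t \<theta>)) has_vector_derivative of_real t * G (w t \<theta>) (\<i> * cis \<theta>)) (at \<theta> within {0..2*pi})"
        by simp
      have "((\<lambda>\<theta>. s (w t \<theta>)) has_vector_derivative Re (g (w t \<theta>) * (of_real t * (\<i> * cis \<theta>)))) (at \<theta> within {0..2*pi})"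
        using circle_angular_derivative[OF D(1)] wt unfolding w_def by blast
      moreover have "Re (g (w t \<theta>) * (of_real t * (\<i> * cis \<theta>))) = - t * Im v"
        by (simp add: v_def algebra_simps)
      ultimately have d2: "((\<lambda>\<theta>. complex_of_real (s (w t \<theta>))) has_vector_derivative of_real (- t * Im v)) (at \<theta> within {0..2*pi})"
        using bounded_linear.has_vector_derivative[OF bounded_linear_of_real] by metis
      have d3: "((\<lambda>\<theta>. cis (- \<theta>)) has_vector_derivative - \<i> * cis (- \<theta>)) (at \<theta> within {0..2*pi})"
        unfolding has_vector_derivative_def by (auto intro!: derivative_eq_intros has_derivative_cis)
      have d: "(A has_vector_derivative - (\<alpha> t * \<i> / of_real t) * (of_real t * G (w t \<theta>) (\<i> * cis \<theta>)) +
          \<beta> 1 * (\<i> * (cis (- \<theta>) * of_real (- t * Im v) + (- \<i> * cis (- \<theta>)) * of_real (s (w t \<theta>))))) (at \<theta> within {0..2*pi})"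
        unfolding A_def
        by (rule has_vector_derivative_add[OF has_vector_derivative_mult_right[OF d1]
              has_vector_derivative_mult_right[OF has_vector_derivative_mult_right[OF has_vector_derivative_mult[OF d3 d2]]]])
      have g_v: "g (w t \<theta>) = cis (- \<theta>) * (of_real (Re v) + \<i> * of_real (Im v))"
      proof -
        have "cis (- \<theta>) * cis \<theta> = 1" by (simp add: cis_mult)
        then have "cis (- \<theta>) * v = g (w t \<theta>)" by (simp add: v_def mult_ac)
        then show ?thesis by (simp add: complex_eq[symmetric] mult.commute)
      qed
      have dbF: "of_real (F (w t \<theta>)) = dbar (G (w t \<theta>))"
        using F[OF wt] Im_dbar_eq_0[OF C2 S(1) wt] by (simp add: complex_eq_iff)
      have \<beta>t: "\<beta> t = of_real t * \<beta> 1" by (simp add: \<beta>_def)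
      have "- (\<alpha> t * \<i> / of_real t) * (of_real t * G (w t \<theta>) (\<i> * cis \<theta>)) = - \<alpha> t * (\<i> * G (w t \<theta>) (\<i> * cis \<theta>))"
        using t by simp
      also have "\<i> * G (w t \<theta>) (\<i> * cis \<theta>) = cis (- \<theta>) * of_real (F (w t \<theta>)) - G (w t \<theta>) (cis \<theta>)"
        using dbar_rotated[of "G (w t \<theta>)" \<theta>] dbF by (simp add: algebra_simps)
      finally have 1: "- (\<alpha> t * \<i> / of_real t) * (of_real t * G (w t \<theta>) (\<i> * cis \<theta>))
          = - \<alpha> t * (cis (- \<theta>) * of_real (F (w t \<theta>)) - G (w t \<theta>) (cis \<theta>))" .
      have 2: "\<beta> 1 * (\<i> * (cis (- \<theta>) * of_real (- t * Im v) + (- \<i> * cis (- \<theta>)) * of_real (s (w t \<theta>))))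
        = \<beta> t * (cis (- \<theta>) * of_real (Re v)) + \<beta> 1 * (cis (- \<theta>) * of_real (s (w t \<theta>))) - \<beta> t * g (w t \<theta>)"
        unfolding \<beta>t g_v by (simp add: algebra_simps)
      show ?thesis
        using d unfolding 1 2 q'_def v_def[symmetric] by (rule has_vector_derivative_eq_rhs) (simp add: algebra_simps)
    qed
    have I0: "((\<lambda>\<theta>. q' t \<theta> - \<alpha> t * (cis (- \<theta>) * of_real (F (w t \<theta>)))) has_integral A (2*pi) - A 0) (cbox 0 (2*pi))"
      using fundamental_theorem_of_calculus[of 0 "2*pi", OF _ dA] by simp
    have "A (2*pi) = A 0"
    proof -
      have "cis (- (2*pi)) = 1" by (simp add: complex_eq_iff)
      then show ?thesis by (simp add: A_def w_def)
    qed
    moreover have "((\<lambda>\<theta>. \<alpha> t * (cis (- \<theta>) * of_real (F (w t \<theta>)))) has_integral h t) (cbox 0 (2*pi))"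
      unfolding h_def
    proof (intro integrable_integral integrable_continuous continuous_intros)
      show "continuous_on (cbox 0 (2*pi)) (\<lambda>\<theta>. F (w t \<theta>))"
        by (rule continuous_on_compose2[OF contF]) (use wS t in \<open>auto simp: w_def intro!: continuous_intros\<close>)
    qed
    ultimately have "((\<lambda>\<theta>. (q' t \<theta> - \<alpha> t * (cis (- \<theta>) * of_real (F (w t \<theta>)))) + \<alpha> t * (cis (- \<theta>) * of_real (F (w t \<theta>)))) has_integral 0 + h t) (cbox 0 (2*pi))"
      using I0 by (intro has_integral_add) auto
    then show ?thesis by (simp add: integral_unique)
  qed
  have "(h has_integral Q \<rho> - Q 0) {0..\<rho>}"
    by (rule fundamental_theorem_of_calculus_interior[OF _ cQ]) (use \<rho> dQ int_q' in auto)
  then have hQ: "integral {0..\<rho>} h = Q \<rho> - Q 0" by (rule integral_unique)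
  have "disk_part \<rho> F z = integral (cbox 0 \<rho>) (\<lambda>t. integral (cbox 0 (2*pi)) (\<lambda>\<theta>.
      F (w t \<theta>) *\<^sub>R (of_real (1 - t\<^sup>2 / \<rho>\<^sup>2) * cis (- \<theta>) / of_real (2 * pi))))"
  proof -
    have "continuous_on (cbox (0, 0) (\<rho>, 2 * pi)) (\<lambda>p. F (w (fst p) (snd p)) *\<^sub>R
        (of_real (1 - (fst p)\<^sup>2 / \<rho>\<^sup>2) * cis (- snd p) / of_real (2 * pi)))"
    proof -
      have box: "cbox (0, 0) (\<rho>, 2 * pi) = {0..\<rho>} \<times> cbox 0 (2*pi)" by (simp add: cbox_Pair_eq)
      show ?thesis unfolding box using \<rho> by (intro continuous_intros cF) auto
    qed
    from integral_prod_continuous[OF this] show ?thesis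
      by (simp add: disk_part_def w_def)
  qed
  also have "\<dots> = integral (cbox 0 \<rho>) (\<lambda>t. 1 / of_real (2 * pi) * h t)"
  proof -
    have "integral (cbox 0 (2*pi)) (\<lambda>\<theta>. F (w t \<theta>) *\<^sub>R (of_real (1 - t\<^sup>2 / \<rho>\<^sup>2) * cis (- \<theta>) / of_real (2 * pi)))
        = 1 / of_real (2 * pi) * h t" for t
      unfolding h_def
      by (subst integral_mult_right[symmetric]) (simp add: \<alpha>_def scaleR_conv_of_real mult_ac)
    then show ?thesis by simp
  qed
  also have "\<dots> = 1 / of_real (2 * pi) * (Q \<rho> - Q 0)"
    using hQ by (simp only: integral_mult_right box_real)
  finally have disk: "disk_part \<rho> F z = 1 / of_real (2 * pi) * (Q \<rho> - Q 0)" .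
  have Q0: "Q 0 = of_real (2 * pi) * g z"
    by (simp add: Q_def q_def \<alpha>_def \<beta>_def w_def scaleR_conv_of_real)
  have "Q \<rho> = of_real (2 * pi) * circle_part \<rho> s z"
    unfolding Q_def circle_part_def q_def
    by (subst integral_mult_right[symmetric])
       (use \<rho> in \<open>simp add: \<alpha>_def \<beta>_def w_def scaleR_conv_of_real power2_eq_square mult_ac\<close>)
  then have "disk_part \<rho> F z = 1 / of_real (2 * pi) * (of_real (2 * pi) * (circle_part \<rho> s z - g z))"
    by (simp only: disk Q0 right_diff_distrib)
  then show ?thesis by simp
qed

section \<open>Translated averages\<close>

lemma average_diff_bound:
  fixes k c :: "'b::euclidean_space \<Rightarrow> complex"
  assumes k: "continuous_on (cbox a b) k" and c: "continuous_on (cbox a b) c"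
  obtains C where "0 \<le> C"
    "\<And>f1 f2 :: complex \<Rightarrow> real. \<And>z \<epsilon> W. 0 \<le> \<epsilon> \<Longrightarrow> continuous_on W f1 \<Longrightarrow> continuous_on W f2 \<Longrightarrow>
      (\<And>y. y \<in> cbox a b \<Longrightarrow> z + c y \<in> W) \<Longrightarrow> (\<And>w. w \<in> W \<Longrightarrow> \<bar>f1 w - f2 w\<bar> \<le> \<epsilon>) \<Longrightarrow>
      norm (integral (cbox a b) (\<lambda>y. f1 (z + c y) *\<^sub>R k y) - integral (cbox a b) (\<lambda>y. f2 (z + c y) *\<^sub>R k y)) \<le> \<epsilon> * C"
proof -
  have "bounded (k ` cbox a b)"
    by (intro compact_imp_bounded compact_continuous_image k compact_cbox)
  then obtain K where K: "0 < K" "\<And>y. y \<in> cbox a b \<Longrightarrow> norm (k y) \<le> K"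
    unfolding bounded_pos by auto
  show ?thesis
  proof (rule that[of "K * measure lborel (cbox a b)"])
    show "0 \<le> K * measure lborel (cbox a b)" using K by simp
    fix f1 f2 :: "complex \<Rightarrow> real" and z \<epsilon> W
    assume \<epsilon>: "0 \<le> \<epsilon>" and f: "continuous_on W f1" "continuous_on W f2"
      and W: "\<And>y. y \<in> cbox a b \<Longrightarrow> z + c y \<in> W" and le: "\<And>w. w \<in> W \<Longrightarrow> \<bar>f1 w - f2 w\<bar> \<le> \<epsilon>"
    have "continuous_on (cbox a b) (\<lambda>y. f (z + c y))" if "continuous_on W f" for f :: "complex \<Rightarrow> real"
      by (rule continuous_on_compose2[OF that]) (use W c in \<open>auto intro!: continuous_intros\<close>)
    then have I: "((\<lambda>y. f (z + c y) *\<^sub>R k y) has_integral integral (cbox a b) (\<lambda>y. f (z + c y) *\<^sub>R k y)) (cbox a b)"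
      if "continuous_on W f" for f :: "complex \<Rightarrow> real"
      using that by (intro integrable_integral integrable_continuous continuous_intros k)
    have "norm (integral (cbox a b) (\<lambda>y. f1 (z + c y) *\<^sub>R k y) - integral (cbox a b) (\<lambda>y. f2 (z + c y) *\<^sub>R k y))
        \<le> (\<epsilon> * K) * measure lborel (cbox a b)"
    proof (rule has_integral_bound[OF _ has_integral_diff[OF I[OF f(1)] I[OF f(2)]]])
      show "0 \<le> \<epsilon> * K" using \<epsilon> K by simp
      fix y assume y: "y \<in> cbox a b"
      have "norm (f1 (z + c y) *\<^sub>R k y - f2 (z + c y) *\<^sub>R k y) = \<bar>f1 (z + c y) - f2 (z + c y)\<bar> * norm (k y)"
        by (simp flip: scaleR_left_diff_distrib)
      also have "\<dots> \<le> \<epsilon> * K"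
        using le[OF W[OF y]] K(2)[OF y] \<epsilon> by (intro mult_mono) auto
      finally show "norm (f1 (z + c y) *\<^sub>R k y - f2 (z + c y) *\<^sub>R k y) \<le> \<epsilon> * K" .
    qed
    then show "norm (integral (cbox a b) (\<lambda>y. f1 (z + c y) *\<^sub>R k y) - integral (cbox a b) (\<lambda>y. f2 (z + c y) *\<^sub>R k y))
        \<le> \<epsilon> * (K * measure lborel (cbox a b))" by (simp add: mult_ac)
  qed
qed

text \<open>
  Averaging translates preserves differentiability and commutes with the derivative. This is
  what raises the regularity of a limit: once \<open>s\<close> and its Laplacian are continuously
  differentiable, so is the right-hand side of the representation formula, which is the
  gradient of \<open>s\<close>.
\<close>

lemma average_has_derivative:
  fixes k c :: "'b::euclidean_space \<Rightarrow> complex" and f :: "complex \<Rightarrow> real"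
  assumes k: "continuous_on (cbox a b) k" and c: "continuous_on (cbox a b) c"
    and U: "open U" "convex U" and W: "\<And>z y. z \<in> U \<Longrightarrow> y \<in> cbox a b \<Longrightarrow> z + c y \<in> W"
    and f: "\<And>w. w \<in> W \<Longrightarrow> (f has_derivative (\<lambda>h. Re (g w * h))) (at w)" and g: "continuous_on W g"
  shows "\<exists>T :: complex \<Rightarrow> complex \<Rightarrow>\<^sub>L complex.
    (\<forall>z\<in>U. ((\<lambda>z. integral (cbox a b) (\<lambda>y. f (z + c y) *\<^sub>R k y)) has_derivative blinfun_apply (T z)) (at z)) \<and>
    continuous_on U T \<and>
    (\<forall>z\<in>U. \<forall>h. T z h = integral (cbox a b) (\<lambda>y. Re (g (z + c y) * h) *\<^sub>R k y))"
proof -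
  define B :: "complex \<Rightarrow> complex \<Rightarrow> complex \<Rightarrow>\<^sub>L complex"
    where "B = (\<lambda>u v. blinfun_mult_right v o\<^sub>L Blinfun of_real o\<^sub>L Blinfun Re o\<^sub>L blinfun_mult_right u)"
  have B: "B u v h = Re (u * h) *\<^sub>R v" for u v h
    by (simp add: B_def bounded_linear_Blinfun_apply bounded_linear_Re bounded_linear_of_real scaleR_conv_of_real mult.commute)
  define \<tau> where "\<tau> = (\<lambda>z y. B (g (z + c y)) (k y))"
  define T where "T = (\<lambda>z. integral (cbox a b) (\<tau> z))"
  have cc: "continuous_on (U \<times> cbox a b) (\<lambda>p. c (snd p))" and ck: "continuous_on (U \<times> cbox a b) (\<lambda>p. k (snd p))"
    by (auto intro!: continuous_on_compose2[OF c] continuous_on_compose2[OF k] continuous_intros)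
  have cg: "continuous_on (U \<times> cbox a b) (\<lambda>p. g (fst p + c (snd p)))"
    by (rule continuous_on_compose2[OF g]) (use W in \<open>auto intro!: continuous_intros cc\<close>)
  have c\<tau>: "continuous_on (U \<times> cbox a b) (\<lambda>(z, y). \<tau> z y)"
    unfolding \<tau>_def B_def split_def
    by (intro continuous_intros bounded_linear.continuous_on[OF bounded_linear_blinfun_mult_right] cg ck)
  have cf: "continuous_on W f"
    using f by (auto intro!: continuous_at_imp_continuous_on has_derivative_continuous)
  show ?thesis
  proof (intro exI[of _ T] conjI ballI allI)
    show "continuous_on U T"
      unfolding T_def by (rule integral_continuous_on_param[OF c\<tau>])
  next
    fix z assume z: "z \<in> U"
    have "((\<lambda>z. integral (cbox a b) (\<lambda>y. f (z + c y) *\<^sub>R k y)) has_derivative blinfun_apply (T z)) (at z within U)"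
      unfolding T_def
    proof (rule leibniz_rule[OF _ _ c\<tau> z U(2)])
      fix z y assume zy: "z \<in> U" "y \<in> cbox a b"
      have d: "((\<lambda>z. z + c y) has_derivative (\<lambda>h. h)) (at z within U)"
        by (auto intro!: derivative_eq_intros)
      have "((\<lambda>z. f (z + c y)) has_derivative (\<lambda>h. Re (g (z + c y) * h))) (at z within U)"
        using has_derivative_compose[OF d f[OF W[OF zy]]] .
      then have "((\<lambda>z. f (z + c y) *\<^sub>R k y) has_derivative (\<lambda>h. Re (g (z + c y) * h) *\<^sub>R k y)) (at z within U)"
        by (rule has_derivative_scaleR_left)
      then show "((\<lambda>z. f (z + c y) *\<^sub>R k y) has_derivative blinfun_apply (\<tau> z y)) (at z within U)"
        by (rule has_derivative_eq_rhs) (simp add: fun_eq_iff \<tau>_def B)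
    next
      fix z assume "z \<in> U"
      then show "(\<lambda>y. f (z + c y) *\<^sub>R k y) integrable_on cbox a b"
        by (intro integrable_continuous continuous_intros k continuous_on_compose2[OF cf])
           (use W c in \<open>auto intro!: continuous_intros\<close>)
    qed
    then show "((\<lambda>z. integral (cbox a b) (\<lambda>y. f (z + c y) *\<^sub>R k y)) has_derivative blinfun_apply (T z)) (at z)"
      by (simp only: at_within_open[OF z U(1)])
  next
    fix z h assume z: "z \<in> U"
    have "\<tau> z integrable_on cbox a b"
    proof (rule integrable_continuous)
      have "continuous_on (cbox a b) ((\<lambda>(z, y). \<tau> z y) \<circ> (\<lambda>y. (z, y)))"
        by (rule continuous_on_compose[OF _ continuous_on_subset[OF c\<tau>]]) (use z in \<open>auto intro!: continuous_intros\<close>)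
      then show "continuous_on (cbox a b) (\<tau> z)" by (simp add: o_def)
    qed
    from blinfun_apply_integral[OF this]
    show "T z h = integral (cbox a b) (\<lambda>y. Re (g (z + c y) * h) *\<^sub>R k y)"
      by (simp add: T_def \<tau>_def B)
  qed
qed

lemma circle_point_in_cball: "0 \<le> t \<Longrightarrow> t \<le> \<rho> \<Longrightarrow> z + of_real t * cis \<theta> \<in> cball z \<rho>"
  by (simp add: dist_norm norm_mult)

lemma disk_box:
  fixes \<rho> :: real
  shows "p \<in> cbox (0, 0) (\<rho>, 2 * pi) \<longleftrightarrow> fst p \<in> {0..\<rho>} \<and> snd p \<in> {0..2 * pi}"
  by (cases p) (auto simp: cbox_Pair_eq box_real)

lemma continuous_kernels:
  assumes "0 < \<rho>"
  shows "continuous_on A (\<lambda>\<theta>. cis (- \<theta>) / of_real (pi * \<rho>))"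
    and "continuous_on A (\<lambda>\<theta>. of_real \<rho> * cis \<theta>)"
    and "continuous_on B (\<lambda>p. of_real (1 - (fst p)\<^sup>2 / \<rho>\<^sup>2) * cis (- snd p) / of_real (2 * pi))"
    and "continuous_on B (\<lambda>p. of_real (fst p) * cis (snd p))"
  using assms by (auto intro!: continuous_intros)

text \<open>
  The right-hand side of the representation formula depends Lipschitz continuously on the
  pair \<open>(s, F)\<close> in the supremum norm. With the second pair zero this is a gradient estimate;
  for differences it carries uniform convergence over to the gradients.
\<close>

lemma gradient_parts_bound:
  assumes \<rho>: "0 < \<rho>"
  obtains C where "0 \<le> C"
    "\<And>s1 s2 F1 F2 :: complex \<Rightarrow> real. \<And>z \<epsilon> W. 0 \<le> \<epsilon> \<Longrightarrow>
      continuous_on W s1 \<Longrightarrow> continuous_on W s2 \<Longrightarrow> continuous_on W F1 \<Longrightarrow> continuous_on W F2 \<Longrightarrow>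
      cball z \<rho> \<subseteq> W \<Longrightarrow> (\<And>w. w \<in> W \<Longrightarrow> \<bar>s1 w - s2 w\<bar> \<le> \<epsilon>) \<Longrightarrow> (\<And>w. w \<in> W \<Longrightarrow> \<bar>F1 w - F2 w\<bar> \<le> \<epsilon>) \<Longrightarrow>
      norm ((circle_part \<rho> s1 z - disk_part \<rho> F1 z) - (circle_part \<rho> s2 z - disk_part \<rho> F2 z)) \<le> \<epsilon> * C"
proof -
  obtain C1 where C1: "0 \<le> C1" "\<And>f1 f2 :: complex \<Rightarrow> real. \<And>z \<epsilon> W. 0 \<le> \<epsilon> \<Longrightarrow> continuous_on W f1 \<Longrightarrow> continuous_on W f2 \<Longrightarrow>
      (\<And>\<theta>. \<theta> \<in> cbox 0 (2 * pi) \<Longrightarrow> z + of_real \<rho> * cis \<theta> \<in> W) \<Longrightarrow> (\<And>w. w \<in> W \<Longrightarrow> \<bar>f1 w - f2 w\<bar> \<le> \<epsilon>) \<Longrightarrow>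
      norm (circle_part \<rho> f1 z - circle_part \<rho> f2 z) \<le> \<epsilon> * C1"
    unfolding circle_part_def
    by (rule average_diff_bound[OF continuous_kernels(1,2)[OF \<rho>], where a = 0 and b = "2 * pi"]) blast
  obtain C2 where C2: "0 \<le> C2" "\<And>f1 f2 :: complex \<Rightarrow> real. \<And>z \<epsilon> W. 0 \<le> \<epsilon> \<Longrightarrow> continuous_on W f1 \<Longrightarrow> continuous_on W f2 \<Longrightarrow>
      (\<And>p. p \<in> cbox (0, 0) (\<rho>, 2 * pi) \<Longrightarrow> z + of_real (fst p) * cis (snd p) \<in> W) \<Longrightarrow> (\<And>w. w \<in> W \<Longrightarrow> \<bar>f1 w - f2 w\<bar> \<le> \<epsilon>) \<Longrightarrow>
      norm (disk_part \<rho> f1 z - disk_part \<rho> f2 z) \<le> \<epsilon> * C2"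
    unfolding disk_part_def
    by (rule average_diff_bound[OF continuous_kernels(3,4)[OF \<rho>], where a = "(0, 0)" and b = "(\<rho>, 2 * pi)"]) blast
  show ?thesis
  proof (rule that[of "C1 + C2"])
    fix s1 s2 F1 F2 :: "complex \<Rightarrow> real" and z \<epsilon> W
    assume \<epsilon>: "0 \<le> \<epsilon>" and cont: "continuous_on W s1" "continuous_on W s2" "continuous_on W F1" "continuous_on W F2"
      and W: "cball z \<rho> \<subseteq> W" and le: "\<And>w. w \<in> W \<Longrightarrow> \<bar>s1 w - s2 w\<bar> \<le> \<epsilon>" "\<And>w. w \<in> W \<Longrightarrow> \<bar>F1 w - F2 w\<bar> \<le> \<epsilon>"
    have 1: "norm (circle_part \<rho> s1 z - circle_part \<rho> s2 z) \<le> \<epsilon> * C1"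
      by (rule C1(2)[OF \<epsilon> cont(1,2) _ le(1)])
         (use W circle_point_in_cball[of \<rho> \<rho>] \<rho> in \<open>auto simp del: mem_cball\<close>)
    have 2: "norm (disk_part \<rho> F1 z - disk_part \<rho> F2 z) \<le> \<epsilon> * C2"
      by (rule C2(2)[OF \<epsilon> cont(3,4) _ le(2)])
         (use W circle_point_in_cball in \<open>force simp: disk_box simp del: mem_cball\<close>)
    have "norm ((circle_part \<rho> s1 z - circle_part \<rho> s2 z) - (disk_part \<rho> F1 z - disk_part \<rho> F2 z)) \<le> \<epsilon> * C1 + \<epsilon> * C2"
      using 1 2 norm_triangle_ineq4 by (meson add_mono order_trans)
    then show "norm ((circle_part \<rho> s1 z - disk_part \<rho> F1 z) - (circle_part \<rho> s2 z - disk_part \<rho> F2 z)) \<le> \<epsilon> * (C1 + C2)"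
      by (simp add: algebra_simps)
  qed (use C1 C2 in simp)
qed

lemma gradient_parts_derivative:
  assumes \<rho>: "0 < \<rho>" and U: "open U" "convex U" and W: "\<And>z. z \<in> U \<Longrightarrow> cball z \<rho> \<subseteq> W"
    and s: "\<And>w. w \<in> W \<Longrightarrow> (s has_derivative (\<lambda>h. Re (g w * h))) (at w)" "continuous_on W g"
    and F: "\<And>w. w \<in> W \<Longrightarrow> (F has_derivative (\<lambda>h. Re (e w * h))) (at w)" "continuous_on W e"
  shows "\<exists>T :: complex \<Rightarrow> complex \<Rightarrow>\<^sub>L complex.
    (\<forall>z\<in>U. ((\<lambda>z. circle_part \<rho> s z - disk_part \<rho> F z) has_derivative blinfun_apply (T z)) (at z)) \<and>
    continuous_on U T \<and>
    (\<forall>z\<in>U. \<forall>h. T z h = circle_part \<rho> (\<lambda>w. Re (g w * h)) z - disk_part \<rho> (\<lambda>w. Re (e w * h)) z)"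
proof -
  have cW: "z + of_real \<rho> * cis \<theta> \<in> W" if "z \<in> U" "\<theta> \<in> cbox 0 (2 * pi)" for z \<theta>
    using W[OF that(1)] circle_point_in_cball[of \<rho> \<rho> z \<theta>] \<rho> by auto
  have dW: "z + of_real (fst p) * cis (snd p) \<in> W" if "z \<in> U" "p \<in> cbox (0, 0) (\<rho>, 2 * pi)" for z p
    using W[OF that(1)] circle_point_in_cball[of "fst p" \<rho> z "snd p"] that(2) by (auto simp: disk_box)
  obtain T1 where T1: "\<forall>z\<in>U. (circle_part \<rho> s has_derivative blinfun_apply (T1 z)) (at z)"
    "continuous_on U T1" "\<forall>z\<in>U. \<forall>h. blinfun_apply (T1 z) h = circle_part \<rho> (\<lambda>w. Re (g w * h)) z"
    using average_has_derivative[OF continuous_kernels(1,2)[OF \<rho>] U cW s]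
    unfolding circle_part_def by blast
  obtain T2 where T2: "\<forall>z\<in>U. (disk_part \<rho> F has_derivative blinfun_apply (T2 z)) (at z)"
    "continuous_on U T2" "\<forall>z\<in>U. \<forall>h. blinfun_apply (T2 z) h = disk_part \<rho> (\<lambda>w. Re (e w * h)) z"
    using average_has_derivative[OF continuous_kernels(3,4)[OF \<rho>] U dW F]
    unfolding disk_part_def by blast
  show ?thesis
  proof (intro exI[of _ "\<lambda>z. T1 z - T2 z"] conjI ballI allI)
    show "((\<lambda>z. circle_part \<rho> s z - disk_part \<rho> F z) has_derivative blinfun_apply (T1 z - T2 z)) (at z)" if "z \<in> U" for z
      by (rule has_derivative_eq_rhs[OF has_derivative_diff[OF T1(1)[rule_format, OF that] T2(1)[rule_format, OF that]]])
         (simp add: fun_eq_iff blinfun.diff_left)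
  qed (use T1 T2 in \<open>auto intro!: continuous_intros simp: blinfun.diff_left\<close>)
qed

section \<open>Compactness for the Liouville equation\<close>

lemma exp_lipschitz_below:
  fixes x y M :: real
  assumes "x \<le> M" "y \<le> M"
  shows "\<bar>exp x - exp y\<bar> \<le> exp M * \<bar>x - y\<bar>"
proof -
  have *: "exp u - exp v \<le> exp M * (u - v)" if "v \<le> u" "u \<le> M" for u v :: real
  proof -
    have le: "1 - exp (v - u) \<le> u - v"
      using exp_ge_add_one_self[of "v - u"] by linarith
    have "exp u - exp v = exp u * (1 - exp (v - u))" by (simp add: right_diff_distrib exp_diff)
    also have "\<dots> \<le> exp u * (u - v)"
      by (intro mult_left_mono le) simp
    also have "\<dots> \<le> exp M * (u - v)" using that by (intro mult_right_mono) auto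
    finally show ?thesis .
  qed
  show ?thesis
    using *[of x y] *[of y x] assms by (cases "y \<le> x") (auto simp: abs_if)
qed

text \<open>
  The equation \<open>\<Delta>s = e\<^sup>2\<^sup>s\<close> for \<open>s = ln \<rho>\<close> says that the metric \<open>\<rho>\<close> has curvature \<open>-1\<close>.
\<close>

definition liouville_solution ::
  "complex set \<Rightarrow> (complex \<Rightarrow> real) \<Rightarrow> (complex \<Rightarrow> complex) \<Rightarrow> (complex \<Rightarrow> complex \<Rightarrow>\<^sub>L complex) \<Rightarrow> bool" where
  "liouville_solution S s g G \<longleftrightarrow>
     has_C2_gradient S s g G \<and> (\<forall>z\<in>S. Re (dbar (G z)) = exp (2 * s z))"

lemma ball_cball_nested:
  assumes "(z::complex) \<in> ball a r" "r + \<rho> \<le> R"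
  shows "cball z \<rho> \<subseteq> ball a R"
proof
  fix w assume "w \<in> cball z \<rho>"
  then show "w \<in> ball a R" using assms dist_triangle[of a w z] by (auto simp: dist_commute)
qed

lemma liouville_gradient:
  assumes sol: "liouville_solution (ball a R) s g G" and "0 < \<rho>" "r + \<rho> \<le> R" "z \<in> ball a r"
  shows "g z = circle_part \<rho> s z - disk_part \<rho> (\<lambda>w. exp (2 * s w)) z"
proof -
  have C2: "has_C2_gradient (ball a R) s g G" using sol by (simp add: liouville_solution_def)
  show ?thesis
    by (rule gradient_representation[OF C2 open_ball ball_cball_nested[OF assms(4,3)] assms(2)])
       (use sol in \<open>auto simp: liouville_solution_def intro!: continuous_intros has_C2_gradientD(3)[OF C2]\<close>)
qed

lemma liouville_gradient_bound:
  assumes "0 < \<rho>"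
  shows "\<exists>L\<ge>0. \<forall>s g G a r z. liouville_solution (ball a (r + \<rho>)) s g G \<longrightarrow>
       (\<forall>w\<in>ball a (r + \<rho>). \<bar>s w\<bar> \<le> B) \<longrightarrow> z \<in> ball a r \<longrightarrow> norm (g z) \<le> L"
proof -
  obtain C where C: "0 \<le> C"
    "\<And>s1 s2 F1 F2 :: complex \<Rightarrow> real. \<And>z \<epsilon> W. 0 \<le> \<epsilon> \<Longrightarrow>
      continuous_on W s1 \<Longrightarrow> continuous_on W s2 \<Longrightarrow> continuous_on W F1 \<Longrightarrow> continuous_on W F2 \<Longrightarrow>
      cball z \<rho> \<subseteq> W \<Longrightarrow> (\<And>w. w \<in> W \<Longrightarrow> \<bar>s1 w - s2 w\<bar> \<le> \<epsilon>) \<Longrightarrow> (\<And>w. w \<in> W \<Longrightarrow> \<bar>F1 w - F2 w\<bar> \<le> \<epsilon>) \<Longrightarrow>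
      norm ((circle_part \<rho> s1 z - disk_part \<rho> F1 z) - (circle_part \<rho> s2 z - disk_part \<rho> F2 z)) \<le> \<epsilon> * C"
    using gradient_parts_bound[OF assms] by blast
  define M where "M = max \<bar>B\<bar> (exp (2 * \<bar>B\<bar>))"
  have "0 \<le> M" by (simp add: M_def)
  show ?thesis
  proof (intro exI[of _ "M * C"] conjI allI impI)
    fix s g G a r z
    assume sol: "liouville_solution (ball a (r + \<rho>)) s g G"
      and bd: "\<forall>w\<in>ball a (r + \<rho>). \<bar>s w\<bar> \<le> B" and z: "z \<in> ball a r"
    have cs: "continuous_on (ball a (r + \<rho>)) s"
      using sol by (auto simp: liouville_solution_def dest: has_C2_gradientD(3))
    have zero: "circle_part \<rho> (\<lambda>_. 0) z - disk_part \<rho> (\<lambda>_. 0) z = 0"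
      by (simp add: circle_part_def disk_part_def)
    have "norm ((circle_part \<rho> s z - disk_part \<rho> (\<lambda>w. exp (2 * s w)) z)
        - (circle_part \<rho> (\<lambda>_. 0) z - disk_part \<rho> (\<lambda>_. 0) z)) \<le> M * C"
    proof (rule C(2)[OF \<open>0 \<le> M\<close> cs _ _ _ ball_cball_nested[OF z order_refl]])
      fix w assume "w \<in> ball a (r + \<rho>)"
      then have "\<bar>s w\<bar> \<le> \<bar>B\<bar>" using bd by fastforce
      then show "\<bar>s w - 0\<bar> \<le> M" "\<bar>exp (2 * s w) - 0\<bar> \<le> M"
        by (auto simp: M_def le_max_iff_disj)
    qed (auto intro!: continuous_intros cs)
    then show "norm (g z) \<le> M * C"
      using liouville_gradient[OF sol assms order_refl z] zero by simp
  qed (use C \<open>0 \<le> M\<close> in simp)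
qed

lemma gradient_lipschitz:
  assumes "\<And>z. z \<in> ball a r \<Longrightarrow> (s has_derivative (\<lambda>h. Re (g z * h))) (at z)"
    and "\<And>z. z \<in> ball a r \<Longrightarrow> norm (g z) \<le> L"
    and "x \<in> ball a r" "y \<in> ball a r"
  shows "\<bar>s x - s y\<bar> \<le> L * norm (x - y)"
proof -
  have "norm (s x - s y) \<le> L * norm (x - y)"
  proof (rule differentiable_bound[OF convex_ball, where f' = "\<lambda>z h. Re (g z * h)"])
    fix z assume z: "z \<in> ball a r"
    show "(s has_derivative (\<lambda>h. Re (g z * h))) (at z within ball a r)"
      using assms(1)[OF z] by (rule has_derivative_at_withinI)
    show "onorm (\<lambda>h. Re (g z * h)) \<le> L"
    proof (rule onorm_le)
      fix h
      have "norm (Re (g z * h)) \<le> norm (g z) * norm h"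
        using abs_Re_le_cmod[of "g z * h"] by (simp only: real_norm_def norm_mult)
      also have "\<dots> \<le> L * norm h" using assms(2)[OF z] by (rule mult_right_mono) simp
      finally show "norm (Re (g z * h)) \<le> L * norm h" .
    qed
  qed (use assms in auto)
  then show ?thesis by simp
qed

text \<open>
  The representation formula is used at two levels. Passing to the limit in it, the
  gradients \<open>g n\<close> converge uniformly to \<open>\<gamma>\<close>, the formula evaluated at \<open>\<sigma>\<close>; hence \<open>\<sigma>\<close> is
  continuously differentiable with gradient \<open>\<gamma>\<close>. Differentiating it, \<open>\<gamma>\<close> is continuously
  differentiable, and its derivative is the same formula applied to first derivatives,
  so it is the limit of the derivatives of \<open>g n\<close> and the Laplacians converge as well. Each
  application of the formula costs a margin \<open>\<rho>\<close>, hence the radii from \<open>4 * \<rho>\<close> down to \<open>\<rho>\<close>.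
\<close>

theorem liouville_uniform_limit:
  fixes s :: "nat \<Rightarrow> complex \<Rightarrow> real"
  assumes \<rho>: "0 < \<rho>"
    and sol: "\<And>n. liouville_solution (ball a (4 * \<rho>)) (s n) (g n) (G n)"
    and bd: "\<And>n w. w \<in> ball a (4 * \<rho>) \<Longrightarrow> \<bar>s n w\<bar> \<le> B"
    and lim: "uniform_limit (ball a (3 * \<rho>)) s \<sigma> sequentially"
  shows "\<exists>\<gamma> \<Gamma>. liouville_solution (ball a \<rho>) \<sigma> \<gamma> \<Gamma>"
proof -
  note C2 = sol[unfolded liouville_solution_def, THEN conjunct1]
  define F where "F = (\<lambda>n w. exp (2 * s n w))"
  define \<Theta> where "\<Theta> = (\<lambda>w. exp (2 * \<sigma> w))"
  have sub: "ball a (3 * \<rho>) \<subseteq> ball a (4 * \<rho>)" "ball a (2 * \<rho>) \<subseteq> ball a (3 * \<rho>)" "ball a \<rho> \<subseteq> ball a (2 * \<rho>)"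
    using \<rho> by (auto intro!: subset_ball)
  have cs: "continuous_on (ball a (3 * \<rho>)) (s n)" for n
    by (rule continuous_on_subset[OF has_C2_gradientD(3)[OF C2] sub(1)])
  have c\<sigma>: "continuous_on (ball a (3 * \<rho>)) \<sigma>"
    by (rule uniform_limit_theorem[OF _ lim]) (simp_all add: cs)
  have \<sigma>lim: "(\<lambda>n. s n w) \<longlonglongrightarrow> \<sigma> w" if "w \<in> ball a (3 * \<rho>)" for w
    by (rule tendsto_uniform_limitI[OF lim that])
  have bd\<sigma>: "\<bar>\<sigma> w\<bar> \<le> B" if "w \<in> ball a (3 * \<rho>)" for w
    by (rule tendsto_upperbound[OF tendsto_rabs[OF \<sigma>lim[OF that]]]) (use bd that sub in auto)
  have Flim: "uniform_limit (ball a (3 * \<rho>)) F \<Theta> sequentially"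
  proof (rule uniform_limitI)
    fix e :: real assume "e > 0"
    then have "e / (2 * exp (2 * B)) > 0" by simp
    from uniform_limitD[OF lim this]
    show "\<forall>\<^sub>F n in sequentially. \<forall>w\<in>ball a (3 * \<rho>). dist (F n w) (\<Theta> w) < e"
    proof (eventually_elim, intro ballI)
      fix n w assume le: "\<forall>w\<in>ball a (3 * \<rho>). dist (s n w) (\<sigma> w) < e / (2 * exp (2 * B))" and w: "w \<in> ball a (3 * \<rho>)"
      have "s n w \<le> B" "\<sigma> w \<le> B" using bd[of w n] bd\<sigma>[OF w] sub w by auto
      then have "\<bar>F n w - \<Theta> w\<bar> \<le> exp (2 * B) * \<bar>2 * s n w - 2 * \<sigma> w\<bar>"
        unfolding F_def \<Theta>_def by (intro exp_lipschitz_below) auto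
      also have "\<dots> < exp (2 * B) * (2 * (e / (2 * exp (2 * B))))"
      proof (rule mult_strict_left_mono)
        have "\<bar>s n w - \<sigma> w\<bar> < e / (2 * exp (2 * B))" using le w by (simp add: dist_real_def)
        then show "\<bar>2 * s n w - 2 * \<sigma> w\<bar> < 2 * (e / (2 * exp (2 * B)))" by linarith
      qed simp
      finally show "dist (F n w) (\<Theta> w) < e" by (simp add: dist_real_def)
    qed
  qed
  have cF: "continuous_on (ball a (3 * \<rho>)) (F n)" for n
    unfolding F_def by (intro continuous_intros cs)
  have c\<Theta>: "continuous_on (ball a (3 * \<rho>)) \<Theta>"
    unfolding \<Theta>_def by (intro continuous_intros c\<sigma>)
  define \<gamma> where "\<gamma> = (\<lambda>z. circle_part \<rho> \<sigma> z - disk_part \<rho> \<Theta> z)"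
  have g_eq: "g n z = circle_part \<rho> (s n) z - disk_part \<rho> (F n) z" if "z \<in> ball a (3 * \<rho>)" for n z
    unfolding F_def by (rule liouville_gradient[OF sol \<rho> _ that]) simp
  obtain C where C: "0 \<le> C"
    "\<And>s1 s2 F1 F2 :: complex \<Rightarrow> real. \<And>z \<epsilon> W. 0 \<le> \<epsilon> \<Longrightarrow>
      continuous_on W s1 \<Longrightarrow> continuous_on W s2 \<Longrightarrow> continuous_on W F1 \<Longrightarrow> continuous_on W F2 \<Longrightarrow>
      cball z \<rho> \<subseteq> W \<Longrightarrow> (\<And>w. w \<in> W \<Longrightarrow> \<bar>s1 w - s2 w\<bar> \<le> \<epsilon>) \<Longrightarrow> (\<And>w. w \<in> W \<Longrightarrow> \<bar>F1 w - F2 w\<bar> \<le> \<epsilon>) \<Longrightarrow>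
      norm ((circle_part \<rho> s1 z - disk_part \<rho> F1 z) - (circle_part \<rho> s2 z - disk_part \<rho> F2 z)) \<le> \<epsilon> * C"
    using gradient_parts_bound[OF \<rho>] by blast
  \<comment> \<open>Uniform convergence is inherited by everything built from \<open>circle_part\<close> and \<open>disk_part\<close>.\<close>
  have parts_lim: "uniform_limit (ball a r) (\<lambda>n z. circle_part \<rho> (p n) z - disk_part \<rho> (q n) z)
      (\<lambda>z. circle_part \<rho> p' z - disk_part \<rho> q' z) sequentially"
    if p: "uniform_limit (ball a (r + \<rho>)) p p' sequentially" "\<And>n. continuous_on (ball a (r + \<rho>)) (p n)"
      and q: "uniform_limit (ball a (r + \<rho>)) q q' sequentially" "\<And>n. continuous_on (ball a (r + \<rho>)) (q n)"
    for p q :: "nat \<Rightarrow> complex \<Rightarrow> real" and p' q' r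
  proof (rule uniform_limitI)
    fix e :: real assume "e > 0"
    define d where "d = e / (2 * (C + 1))"
    have d: "d > 0" "d * C < e"
      using \<open>e > 0\<close> C(1) by (auto simp: d_def field_simps intro: add_nonneg_pos)
    have cp': "continuous_on (ball a (r + \<rho>)) p'" and cq': "continuous_on (ball a (r + \<rho>)) q'"
      by (rule uniform_limit_theorem[OF _ p(1)] uniform_limit_theorem[OF _ q(1)]; simp add: p q)+
    show "\<forall>\<^sub>F n in sequentially. \<forall>z\<in>ball a r. dist (circle_part \<rho> (p n) z - disk_part \<rho> (q n) z)
        (circle_part \<rho> p' z - disk_part \<rho> q' z) < e"
      using uniform_limitD[OF p(1) d(1)] uniform_limitD[OF q(1) d(1)]
    proof (eventually_elim, intro ballI)
      fix n z
      assume le: "\<forall>w\<in>ball a (r + \<rho>). dist (p n w) (p' w) < d" "\<forall>w\<in>ball a (r + \<rho>). dist (q n w) (q' w) < d"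
        and z: "z \<in> ball a r"
      have "norm ((circle_part \<rho> (p n) z - disk_part \<rho> (q n) z) - (circle_part \<rho> p' z - disk_part \<rho> q' z)) \<le> d * C"
        by (rule C(2)[OF less_imp_le[OF d(1)] p(2) cp' q(2) cq' ball_cball_nested[OF z order_refl]])
           (use le in \<open>auto simp: dist_real_def intro: less_imp_le\<close>)
      then show "dist (circle_part \<rho> (p n) z - disk_part \<rho> (q n) z) (circle_part \<rho> p' z - disk_part \<rho> q' z) < e"
        using d(2) by (simp add: dist_norm)
    qed
  qed
  have "uniform_limit (ball a (2 * \<rho>)) (\<lambda>n z. circle_part \<rho> (s n) z - disk_part \<rho> (F n) z) \<gamma> sequentially"
    unfolding \<gamma>_def by (rule parts_lim) (use lim Flim cs cF in \<open>simp_all\<close>)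
  then have glim: "uniform_limit (ball a (2 * \<rho>)) g \<gamma> sequentially"
    by (rule uniform_limit_cong'[THEN iffD1, rotated -1]) (use g_eq sub in auto)
  have cg: "continuous_on (ball a (2 * \<rho>)) (g n)" for n
    using has_C2_gradientD(4)[OF C2] by (rule continuous_on_subset) (use sub in auto)
  have c\<gamma>: "continuous_on (ball a (2 * \<rho>)) \<gamma>"
    by (rule uniform_limit_theorem[OF _ glim]) (simp_all add: cg)
  have d\<sigma>: "(\<sigma> has_derivative (\<lambda>h. Re (\<gamma> z * h))) (at z)" if z: "z \<in> ball a (2 * \<rho>)" for z
  proof -
    have a: "a \<in> ball a (2 * \<rho>)" using \<rho> by simp
    have D1: "(s n has_derivative (\<lambda>h. Re (g n x * h))) (at x within ball a (2 * \<rho>))"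
      if "x \<in> ball a (2 * \<rho>)" for n x
      using has_C2_gradientD(1)[OF C2] sub that by (blast intro: has_derivative_at_withinI)
    have D2: "\<forall>\<^sub>F n in sequentially. \<forall>x\<in>ball a (2 * \<rho>). \<forall>h. norm (Re (g n x * h) - Re (\<gamma> x * h)) \<le> e * norm h"
      if "e > 0" for e :: real
      using uniform_limitD[OF glim that]
    proof (eventually_elim, intro ballI allI)
      fix n x h assume le: "\<forall>x\<in>ball a (2 * \<rho>). dist (g n x) (\<gamma> x) < e" and x: "x \<in> ball a (2 * \<rho>)"
      have "norm (Re (g n x * h) - Re (\<gamma> x * h)) = \<bar>Re ((g n x - \<gamma> x) * h)\<bar>"
        by (simp add: algebra_simps)
      also have "\<dots> \<le> norm (g n x - \<gamma> x) * norm h"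
        using abs_Re_le_cmod[of "(g n x - \<gamma> x) * h"] by (simp only: norm_mult)
      also have "\<dots> \<le> e * norm h"
        using le x by (intro mult_right_mono) (auto simp: dist_norm intro: less_imp_le)
      finally show "norm (Re (g n x * h) - Re (\<gamma> x * h)) \<le> e * norm h" .
    qed
    have "(\<lambda>n. s n a) \<longlonglongrightarrow> \<sigma> a" using \<sigma>lim \<rho> by simp
    from has_derivative_sequence[of "ball a (2 * \<rho>)" s "\<lambda>n x h. Re (g n x * h)" "\<lambda>x h. Re (\<gamma> x * h)", OF convex_ball D1 D2 a this]
    obtain u where u: "\<And>x. x \<in> ball a (2 * \<rho>) \<Longrightarrow> (\<lambda>n. s n x) \<longlonglongrightarrow> u x"
      "\<And>x. x \<in> ball a (2 * \<rho>) \<Longrightarrow> (u has_derivative (\<lambda>h. Re (\<gamma> x * h))) (at x within ball a (2 * \<rho>))"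
      by blast
    have u\<sigma>: "u x = \<sigma> x" if "x \<in> ball a (2 * \<rho>)" for x
      using LIMSEQ_unique[OF u(1)[OF that] \<sigma>lim] that sub by blast
    have "(u has_derivative (\<lambda>h. Re (\<gamma> z * h))) (at z)"
      using u(2)[OF z] by (simp only: at_within_open[OF z open_ball])
    then show ?thesis
      by (rule has_derivative_transform_within_open[OF _ open_ball z]) (rule u\<sigma>)
  qed
  have dexp: "((\<lambda>w. exp (2 * f w)) has_derivative (\<lambda>h. Re ((2 * exp (2 * f z)) *\<^sub>R e * h))) (at z)"
    if "(f has_derivative (\<lambda>h. Re (e * h))) (at z)" for f :: "complex \<Rightarrow> real" and e z
    by (rule has_derivative_eq_rhs[OF has_derivative_exp[OF has_derivative_mult_right[OF that]]])
       (simp add: fun_eq_iff algebra_simps)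
  have inW: "cball z \<rho> \<subseteq> ball a (2 * \<rho>)" if "z \<in> ball a \<rho>" for z
    by (rule ball_cball_nested[OF that]) simp
  have d\<Theta>: "(\<Theta> has_derivative (\<lambda>h. Re ((2 * \<Theta> w) *\<^sub>R \<gamma> w * h))) (at w)" if "w \<in> ball a (2 * \<rho>)" for w
    using dexp[OF d\<sigma>[OF that]] by (simp only: \<Theta>_def)
  have c\<Theta>': "continuous_on (ball a (2 * \<rho>)) (\<lambda>w. (2 * \<Theta> w) *\<^sub>R \<gamma> w)"
    by (intro continuous_intros c\<gamma> continuous_on_subset[OF c\<Theta> sub(2)])
  obtain T :: "complex \<Rightarrow> complex \<Rightarrow>\<^sub>L complex" where T:
    "\<forall>z\<in>ball a \<rho>. (\<gamma> has_derivative blinfun_apply (T z)) (at z)" "continuous_on (ball a \<rho>) T"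
    "\<forall>z\<in>ball a \<rho>. \<forall>h. T z h = circle_part \<rho> (\<lambda>w. Re (\<gamma> w * h)) z - disk_part \<rho> (\<lambda>w. Re ((2 * \<Theta> w) *\<^sub>R \<gamma> w * h)) z"
    using gradient_parts_derivative[OF \<rho> open_ball convex_ball inW d\<sigma> c\<gamma> d\<Theta> c\<Theta>']
    unfolding \<gamma>_def[symmetric] by blast
  have "has_C2_gradient (ball a \<rho>) \<sigma> \<gamma> T"
    unfolding has_C2_gradient_def using d\<sigma> T sub(3) by blast
  moreover have "Re (dbar (T z)) = exp (2 * \<sigma> z)" if z: "z \<in> ball a \<rho>" for z
  proof -
    have Gn: "G n z h = circle_part \<rho> (\<lambda>w. Re (g n w * h)) z - disk_part \<rho> (\<lambda>w. Re ((2 * F n w) *\<^sub>R g n w * h)) z" for n h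
    proof -
      have dsn: "(s n has_derivative (\<lambda>h. Re (g n w * h))) (at w)" if "w \<in> ball a (2 * \<rho>)" for w
        using has_C2_gradientD(1)[OF C2] that sub by blast
      have dFn: "(F n has_derivative (\<lambda>h. Re ((2 * F n w) *\<^sub>R g n w * h))) (at w)" if "w \<in> ball a (2 * \<rho>)" for w
        using dexp[OF dsn[OF that]] by (simp only: F_def)
      have cFn: "continuous_on (ball a (2 * \<rho>)) (\<lambda>w. (2 * F n w) *\<^sub>R g n w)"
        by (intro continuous_intros cg continuous_on_subset[OF cF sub(2)])
      obtain T' :: "complex \<Rightarrow> complex \<Rightarrow>\<^sub>L complex" where T':
        "\<forall>z\<in>ball a \<rho>. ((\<lambda>z. circle_part \<rho> (s n) z - disk_part \<rho> (F n) z) has_derivative blinfun_apply (T' z)) (at z)"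
        "\<forall>z\<in>ball a \<rho>. \<forall>h. T' z h = circle_part \<rho> (\<lambda>w. Re (g n w * h)) z - disk_part \<rho> (\<lambda>w. Re ((2 * F n w) *\<^sub>R g n w * h)) z"
        using gradient_parts_derivative[OF \<rho> open_ball convex_ball inW dsn cg dFn cFn] by blast
      have "((\<lambda>z. circle_part \<rho> (s n) z - disk_part \<rho> (F n) z) has_derivative blinfun_apply (G n z)) (at z)"
        by (rule has_derivative_transform_within_open[OF has_C2_gradientD(2)[OF C2, of z n] open_ball z])
           (use z sub in blast, use g_eq sub in \<open>simp add: subset_iff\<close>)
      from has_derivative_unique[OF this T'(1)[rule_format, OF z]] show ?thesis using T'(2) z by simp
    qed
    have bF: "bounded (\<Theta> ` ball a (2 * \<rho>))"
    proof (rule boundedI)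
      fix x assume "x \<in> \<Theta> ` ball a (2 * \<rho>)"
      then obtain w where "w \<in> ball a (3 * \<rho>)" "x = \<Theta> w" using sub by blast
      then show "norm x \<le> exp (2 * B)" using bd\<sigma>[of w] by (auto simp: \<Theta>_def)
    qed
    have b\<gamma>: "bounded (\<gamma> ` ball a (2 * \<rho>))"
    proof -
      obtain L where L: "\<forall>s g G a r z. liouville_solution (ball a (r + \<rho>)) s g G \<longrightarrow>
         (\<forall>w\<in>ball a (r + \<rho>). \<bar>s w\<bar> \<le> B) \<longrightarrow> z \<in> ball a r \<longrightarrow> norm (g z) \<le> L"
        using liouville_gradient_bound[OF \<rho>] by blast
      have gL: "norm (g n w) \<le> L" if "w \<in> ball a (2 * \<rho>)" for n w
      proof (rule L[rule_format, of a "3 * \<rho>" "s n" "g n" "G n"])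
        have eq: "3 * \<rho> + \<rho> = 4 * \<rho>" by simp
        show "liouville_solution (ball a (3 * \<rho> + \<rho>)) (s n) (g n) (G n)"
          unfolding eq by (rule sol)
        show "\<bar>s n w\<bar> \<le> B" if "w \<in> ball a (3 * \<rho> + \<rho>)" for w
          using that unfolding eq by (rule bd)
      qed (use that sub in blast)
      show ?thesis
      proof (rule boundedI)
        fix x assume "x \<in> \<gamma> ` ball a (2 * \<rho>)"
        then obtain w where w: "w \<in> ball a (2 * \<rho>)" "x = \<gamma> w" by blast
        show "norm x \<le> L"
          unfolding w(2)
          by (rule tendsto_upperbound[OF tendsto_norm[OF tendsto_uniform_limitI[OF glim w(1)]]]) (use gL w in auto)
      qed
    qed
    have Glim: "(\<lambda>n. G n z h) \<longlonglongrightarrow> T z h" for h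
    proof -
      have Re_lim: "uniform_limit (ball a (2 * \<rho>)) (\<lambda>n w. Re (p n w * h)) (\<lambda>w. Re (p' w * h)) sequentially"
        if "uniform_limit (ball a (2 * \<rho>)) p p' sequentially" for p p'
        by (rule bounded_linear.uniform_limit[OF _ that])
           (intro bounded_linear_compose[OF bounded_linear_Re] bounded_linear_mult_left)
      have 1: "uniform_limit (ball a (2 * \<rho>)) (\<lambda>n w. Re (g n w * h)) (\<lambda>w. Re (\<gamma> w * h)) sequentially"
        by (rule Re_lim[OF glim])
      have F2: "uniform_limit (ball a (2 * \<rho>)) F \<Theta> sequentially"
        using Flim sub(2) by (rule uniform_limit_on_subset)
      have "uniform_limit (ball a (2 * \<rho>)) (\<lambda>n w. F n w *\<^sub>R g n w) (\<lambda>w. \<Theta> w *\<^sub>R \<gamma> w) sequentially"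
        by (rule bounded_bilinear.bounded_uniform_limit[OF bounded_bilinear_scaleR F2 glim b\<gamma> bF])
      then have "uniform_limit (ball a (2 * \<rho>)) (\<lambda>n w. 2 *\<^sub>R (F n w *\<^sub>R g n w)) (\<lambda>w. 2 *\<^sub>R (\<Theta> w *\<^sub>R \<gamma> w)) sequentially"
        by (rule bounded_linear.uniform_limit[OF bounded_linear_scaleR_right])
      then have 2: "uniform_limit (ball a (2 * \<rho>)) (\<lambda>n w. Re ((2 * F n w) *\<^sub>R g n w * h)) (\<lambda>w. Re ((2 * \<Theta> w) *\<^sub>R \<gamma> w * h)) sequentially"
        unfolding scaleR_scaleR by (rule Re_lim)
      have "uniform_limit (ball a \<rho>)
          (\<lambda>n z. circle_part \<rho> (\<lambda>w. Re (g n w * h)) z - disk_part \<rho> (\<lambda>w. Re ((2 * F n w) *\<^sub>R g n w * h)) z)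
          (\<lambda>z. circle_part \<rho> (\<lambda>w. Re (\<gamma> w * h)) z - disk_part \<rho> (\<lambda>w. Re ((2 * \<Theta> w) *\<^sub>R \<gamma> w * h)) z) sequentially"
      proof (rule parts_lim)
        show "continuous_on (ball a (\<rho> + \<rho>)) (\<lambda>w. Re (g n w * h))" for n
          using cg by (auto intro!: continuous_intros)
        show "continuous_on (ball a (\<rho> + \<rho>)) (\<lambda>w. Re ((2 * F n w) *\<^sub>R g n w * h))" for n
          using cg continuous_on_subset[OF cF sub(2)] by (auto intro!: continuous_intros)
      qed (use 1 2 in simp_all)
      from tendsto_uniform_limitI[OF this z] show ?thesis by (simp only: Gn T(3)[rule_format, OF z])
    qed
    have "(\<lambda>n. Re (dbar (G n z))) \<longlonglongrightarrow> Re (dbar (T z))"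
      unfolding dbar_def by (intro tendsto_intros Glim)
    moreover have "Re (dbar (G n z)) = F n z" for n
      using sol[of n] z sub unfolding liouville_solution_def F_def by blast
    moreover have "(\<lambda>n. F n z) \<longlonglongrightarrow> \<Theta> z"
      by (rule tendsto_uniform_limitI[OF Flim]) (use z sub in blast)
    ultimately show ?thesis
      using LIMSEQ_unique unfolding \<Theta>_def by simp
  qed
  ultimately show ?thesis
    unfolding liouville_solution_def by blast
qed

section \<open>From local to global\<close>

lemma gradient_unique:
  assumes "(f has_derivative (\<lambda>h. Re (c * h))) (at z)" "(f has_derivative (\<lambda>h. Re (d * h))) (at (z::complex))"
  shows "c = d"
proof -
  have eq: "(\<lambda>h. Re (c * h)) = (\<lambda>h. Re (d * h))"
    by (rule has_derivative_unique[OF assms])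
  from fun_cong[OF eq, of 1] fun_cong[OF eq, of \<i>] show ?thesis
    by (simp add: complex_eq_iff)
qed

lemma C2_on_cong:
  assumes "open S" "\<And>z. z \<in> S \<Longrightarrow> f z = f' z" "C2_on S f"
  shows "C2_on S f'"
proof -
  obtain g G where gG: "has_C2_gradient S f g G"
    using assms(3) C2_on_iff_gradient by blast
  have "has_C2_gradient S f' g G"
    unfolding has_C2_gradient_def
  proof (intro conjI ballI)
    fix z assume z: "z \<in> S"
    show "(f' has_derivative (\<lambda>h. Re (g z * h))) (at z)"
      by (rule has_derivative_transform_within_open[OF has_C2_gradientD(1)[OF gG z] assms(1) z assms(2)])
  qed (use has_C2_gradientD[OF gG] in auto)
  then show ?thesis using C2_on_iff_gradient by blast
qed

text \<open>
  The local derivatives agree on overlaps because derivatives are unique; evaluating at each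
  point the data of the disk centred there glues them together.
\<close>

lemma C2_on_locally:
  assumes loc: "\<And>a. a \<in> S \<Longrightarrow> \<exists>r>0. ball a r \<subseteq> S \<and> C2_on (ball a r) f"
  shows "C2_on S f"
proof -
  have "\<forall>a\<in>S. \<exists>r g G. r > 0 \<and> ball a r \<subseteq> S \<and> has_C2_gradient (ball a r) f g G"
    using loc C2_on_iff_gradient by blast
  then obtain r g G where rgG: "\<And>a. a \<in> S \<Longrightarrow> r a > 0 \<and> ball a (r a) \<subseteq> S \<and> has_C2_gradient (ball a (r a)) f (g a) (G a)"
    by metis
  have C2: "has_C2_gradient (ball a (r a)) f (g a) (G a)" and sub: "ball a (r a) \<subseteq> S"
    and centre: "a \<in> ball a (r a)" if "a \<in> S" for a
    using rgG[OF that] by simp_all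
  define g' where "g' = (\<lambda>a. g a a)"
  define G' where "G' = (\<lambda>a. G a a)"
  have g': "g a w = g' w" if "a \<in> S" "w \<in> ball a (r a)" for a w
  proof -
    have w: "w \<in> S" using sub[OF that(1)] that(2) by blast
    show ?thesis
      unfolding g'_def
      by (rule gradient_unique[OF has_C2_gradientD(1)[OF C2[OF that(1)] that(2)]
            has_C2_gradientD(1)[OF C2[OF w] centre[OF w]]])
  qed
  have dg': "(g' has_derivative blinfun_apply (G a w)) (at w)" if "a \<in> S" "w \<in> ball a (r a)" for a w
    by (rule has_derivative_transform_within_open[OF has_C2_gradientD(2)[OF C2[OF that(1)] that(2)] open_ball that(2) g'[OF that(1)]])
  have G': "G a w = G' w" if "a \<in> S" "w \<in> ball a (r a)" for a w
  proof -
    have w: "w \<in> S" using sub[OF that(1)] that(2) by blast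
    from has_derivative_unique[OF dg'[OF that] dg'[OF w centre[OF w]]]
    show ?thesis by (simp add: G'_def blinfun_apply_inject)
  qed
  have "has_C2_gradient S f g' G'"
    unfolding has_C2_gradient_def
  proof (intro conjI ballI continuous_at_imp_continuous_on)
    fix a assume a: "a \<in> S"
    show "(f has_derivative (\<lambda>h. Re (g' a * h))) (at a)"
      using has_C2_gradientD(1)[OF C2[OF a] centre[OF a]] by (simp only: g'_def)
    show "(g' has_derivative blinfun_apply (G' a)) (at a)"
      using dg'[OF a centre[OF a]] by (simp only: G'_def)
    have "continuous_on (ball a (r a)) G'"
      using has_C2_gradientD(5)[OF C2[OF a]] by (rule continuous_on_eq) (rule G'[OF a])
    then show "isCont G' a"
      using centre[OF a] by (simp add: continuous_on_eq_continuous_at)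
  qed
  then show ?thesis using C2_on_iff_gradient by blast
qed

section \<open>Perron families\<close>

lemma curvature_minus_one_imp_liouville_solution:
  assumes "open K" "regular_metric_curvature_minus_one K \<sigma>"
  shows "\<exists>g G. liouville_solution K (\<lambda>z. ln (\<sigma> z)) g G"
proof -
  have pos: "0 < \<sigma> z" if "z \<in> K" for z
    using assms(2) that by (auto simp: regular_metric_curvature_minus_one_def conformal_metric_def)
  then have "{z \<in> K. 0 < \<sigma> z} = K" by auto
  then have "C2_on K \<sigma>"
    using assms(2) by (simp add: regular_metric_curvature_minus_one_def regular_on_def)
  then have "C2_on K (\<lambda>z. ln (\<sigma> z))" using pos by (rule C2_on_ln)
  then obtain g G where gG: "has_C2_gradient K (\<lambda>z. ln (\<sigma> z)) g G"
    using C2_on_iff_gradient by blast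
  have "Re (dbar (G z)) = exp (2 * ln (\<sigma> z))" if z: "z \<in> K" for z
  proof -
    have "curvature \<sigma> z = -1"
      using assms(2) z by (simp add: regular_metric_curvature_minus_one_def)
    then have "ereal (Re (dbar (G z))) = ereal ((\<sigma> z)\<^sup>2)"
      using curvature_eq_minus_one_iff[of \<sigma> z] pos[OF z] lower_laplacian_C2[OF gG assms(1) z] by simp
    moreover have "exp (2 * ln (\<sigma> z)) = (\<sigma> z)\<^sup>2"
      using pos[OF z] by (simp add: exp_double)
    ultimately show ?thesis by simp
  qed
  then show ?thesis using gG unfolding liouville_solution_def by blast
qed

lemma liouville_solution_imp_curvature_minus_one:
  assumes S: "open S" "z \<in> S" and sol: "liouville_solution S (\<lambda>z. ln (\<sigma> z)) g G" and pos: "0 < \<sigma> z"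
  shows "curvature \<sigma> z = -1"
proof -
  have "lower_laplacian (\<lambda>w. ln (\<sigma> w)) z = ereal (exp (2 * ln (\<sigma> z)))"
    using sol S lower_laplacian_C2[of S "\<lambda>z. ln (\<sigma> z)" g G z] by (auto simp: liouville_solution_def)
  then show ?thesis
    using pos by (simp add: curvature_eq_minus_one_iff exp_double)
qed

text \<open>
  Finitely many requirements that can be met one at a time, and that persist when the
  density grows, are met together by the maximum. It serves to find a member that is positive on
  a compact set, and one close to the supremum on a finite net.
\<close>

lemma perron_family_finite_max:
  assumes P: "perron_family G \<Phi>" "\<Phi> \<noteq> {}" and "finite D"
    and Q: "\<And>d. d \<in> D \<Longrightarrow> \<exists>\<rho>\<in>\<Phi>. Q d \<rho>"
    and up: "\<And>d \<rho> \<sigma>. Q d \<rho> \<Longrightarrow> (\<And>z. \<rho> z \<le> \<sigma> z) \<Longrightarrow> Q d \<sigma>"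
  shows "\<exists>\<rho>\<in>\<Phi>. \<forall>d\<in>D. Q d \<rho>"
  using \<open>finite D\<close> Q
proof (induction D rule: finite_induct)
  case empty
  then show ?case using P by auto
next
  case (insert d D)
  obtain \<rho> where \<rho>: "\<rho> \<in> \<Phi>" "\<forall>d\<in>D. Q d \<rho>" using insert by blast
  obtain \<sigma> where \<sigma>: "\<sigma> \<in> \<Phi>" "Q d \<sigma>" using insert.prems by blast
  have "(\<lambda>z. max (\<rho> z) (\<sigma> z)) \<in> \<Phi>"
    using P \<rho> \<sigma> by (simp add: perron_family_def)
  moreover have "Q e (\<lambda>z. max (\<rho> z) (\<sigma> z))" if "e \<in> insert d D" for e
    using that
  proof
    assume "e = d"
    then show ?thesis using up[of d \<sigma>, OF \<sigma>(2)] by simp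
  next
    assume "e \<in> D"
    then show ?thesis using up[of e \<rho>] \<rho>(2) by simp
  qed
  ultimately show ?case by blast
qed

text \<open>
  A modification is positive on its disk, and finitely many disks cover the compact set.
\<close>

lemma perron_family_positive_on_cball:
  assumes P: "perron_family G \<Phi>" "\<Phi> \<noteq> {}" and G: "open G" "cball a r \<subseteq> G"
  shows "\<exists>\<mu>\<in>\<Phi>. \<forall>z\<in>cball a r. 0 < \<mu> z"
proof -
  obtain \<rho>0 where \<rho>0: "\<rho>0 \<in> \<Phi>" using P by blast
  have "\<forall>z\<in>cball a r. \<exists>e>0. cball z e \<subseteq> G"
    using G by (meson open_contains_cball subsetD)
  then obtain e where e: "\<And>z. z \<in> cball a r \<Longrightarrow> e z > 0 \<and> cball z (e z) \<subseteq> G" by metis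
  have cover: "cball a r \<subseteq> (\<Union>z\<in>cball a r. ball z (e z))"
    using e by (auto intro!: bexI[of _ "_ :: complex"])
  obtain D where D: "D \<subseteq> cball a r" "finite D" "cball a r \<subseteq> (\<Union>z\<in>D. ball z (e z))"
    by (rule compactE_image[OF compact_cball[of a r], of "cball a r" "\<lambda>z. ball z (e z)"]) (use cover in auto)
  have "\<exists>\<mu>\<in>\<Phi>. \<forall>d\<in>D. \<forall>w\<in>ball d (e d). 0 < \<mu> w"
  proof (rule perron_family_finite_max[OF P D(2)])
    fix d assume d: "d \<in> D"
    then obtain \<sigma> where \<sigma>: "\<sigma> \<in> \<Phi>" "is_modification G (ball d (e d)) \<rho>0 \<sigma>"
      using P(1) \<rho>0 e[of d] D(1) unfolding perron_family_def by blast
    have "\<forall>w\<in>ball d (e d). 0 < \<sigma> w"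
      using \<sigma>(2) by (simp add: is_modification_def regular_metric_curvature_minus_one_def conformal_metric_def)
    then show "\<exists>\<rho>\<in>\<Phi>. \<forall>w\<in>ball d (e d). 0 < \<rho> w" using \<sigma>(1) by blast
  qed (meson less_le_trans)
  then show ?thesis using D(3) by blast
qed

text \<open>
  Taking the maximum with \<open>\<mu>\<close> before modifying makes the density positive on the boundary
  circle, so that the comparison on the closed disk applies and modification does not
  decrease it.
\<close>

lemma perron_family_dominating_modification:
  assumes P: "perron_family G \<Phi>" and r: "0 < r" "cball a r \<subseteq> G"
    and \<mu>: "\<mu> \<in> \<Phi>" "\<And>z. z \<in> cball a r \<Longrightarrow> 0 < \<mu> z" and \<rho>: "\<rho> \<in> \<Phi>"
  shows "\<exists>\<sigma>\<in>\<Phi>. regular_metric_curvature_minus_one (ball a r) \<sigma> \<and>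
    (\<forall>z\<in>cball a r. \<rho> z \<le> \<sigma> z \<and> \<mu> z \<le> \<sigma> z)"
proof -
  define \<tau> where "\<tau> = (\<lambda>z. max (\<rho> z) (\<mu> z))"
  have \<tau>: "\<tau> \<in> \<Phi>" using P \<mu> \<rho> by (simp add: perron_family_def \<tau>_def)
  then obtain \<sigma> where \<sigma>: "\<sigma> \<in> \<Phi>" "is_modification G (ball a r) \<tau> \<sigma>"
    using P r unfolding perron_family_def by blast
  have reg: "regular_metric_curvature_minus_one (ball a r) \<sigma>" and eq: "\<And>z. z \<in> G - ball a r \<Longrightarrow> \<sigma> z = \<tau> z"
    using \<sigma>(2) by (auto simp: is_modification_def)
  have sk: "sk_metric G \<tau>" "sk_metric G \<sigma>" using P \<tau> \<sigma> by (auto simp: perron_family_def)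
  have "\<tau> z \<le> \<sigma> z" if "z \<in> cball a r" for z
  proof (rule sk_metric_le_curvature_minus_one[OF sk(1) r(2) _ _ _ _ that])
    show "continuous_on (cball a r) \<sigma>"
      using sk_metric_continuous[OF sk(2)] r(2) by (rule continuous_on_subset)
    show "curvature \<sigma> w = -1" if "w \<in> ball a r" for w
      using reg that by (simp add: regular_metric_curvature_minus_one_def)
    show "\<tau> w \<le> \<sigma> w" if "w \<in> sphere a r" for w
      using eq[of w] that r by auto
    show "0 < \<sigma> w" if w: "w \<in> cball a r" for w
    proof (cases "w \<in> ball a r")
      case True
      then show ?thesis using reg by (simp add: regular_metric_curvature_minus_one_def conformal_metric_def)
    next
      case False
      then have "\<sigma> w = \<tau> w" using eq[of w] w r by blast
      then show ?thesis using \<mu>(2)[OF w] by (simp add: \<tau>_def)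
    qed
  qed
  then show ?thesis using \<sigma>(1) reg by (fastforce simp: \<tau>_def)
qed

lemma perron_family_bdd_above:
  assumes P: "perron_family G \<Phi>" and G: "open G" "z \<in> G"
  shows "bdd_above ((\<lambda>f. f z) ` \<Phi>)"
proof -
  obtain r where r: "r > 0" "cball z r \<subseteq> G" using G open_contains_cball by blast
  have "f z \<le> 6 * r / (r\<^sup>2 - (norm (z - z))\<^sup>2)" if "f \<in> \<Phi>" for f
    by (rule sk_metric_bound[OF _ r(2)]) (use P that r in \<open>auto simp: perron_family_def\<close>)
  then show ?thesis by (auto intro!: bdd_aboveI)
qed

text \<open>
  On a small disk the supremum may be taken over the class \<open>\<Psi>\<close> of those members of the
  family that have curvature \<open>-1\<close> there and lie above a fixed positive member \<open>\<mu>\<close>.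
  Logarithms of members of \<open>\<Psi>\<close> are bounded, by \<open>\<mu>\<close> from below and by Ahlfors' lemma from
  above, so the gradient estimate makes them equi-Lipschitz. As every member of the family
  is dominated by one of \<open>\<Psi>\<close>, the supremum is a uniform limit of a sequence in \<open>\<Psi>\<close>.
\<close>

lemma perron_sup_local_solution:
  assumes P: "perron_family G \<Phi>" "\<Phi> \<noteq> {}" and G: "open G" "a \<in> G"
  defines "\<Lambda> \<equiv> \<lambda>z. SUP f\<in>\<Phi>. f z"
  shows "\<exists>\<rho>>0. ball a \<rho> \<subseteq> G \<and> (\<forall>z\<in>ball a \<rho>. 0 < \<Lambda> z) \<and>
    (\<exists>g H. liouville_solution (ball a \<rho>) (\<lambda>z. ln (\<Lambda> z)) g H)"
proof -
  obtain R where R: "R > 0" "cball a R \<subseteq> G" using G open_contains_cball by blast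
  \<comment> \<open>The radii: Ahlfors' lemma on \<open>10 * \<rho>\<close> gives bounds on \<open>5 * \<rho>\<close>, where the modifications live;
    the gradient estimate then holds on \<open>4 * \<rho>\<close>, which contains the compact disk of radius
    \<open>3 * \<rho>\<close> for the finite net, and the limit theorem ends at radius \<open>\<rho>\<close>.\<close>
  define \<rho> where "\<rho> = R / 10"
  have \<rho>: "\<rho> > 0" "cball a (10 * \<rho>) \<subseteq> G" using R by (auto simp: \<rho>_def)
  have sub: "cball a (5 * \<rho>) \<subseteq> G" "cball a (5 * \<rho>) \<subseteq> ball a (10 * \<rho>)"
    using \<rho> by (auto intro: order_trans[OF subset_cball])
  have sk: "sk_metric G f" if "f \<in> \<Phi>" for f using P that by (simp add: perron_family_def)
  have bdd: "bdd_above ((\<lambda>f. f z) ` \<Phi>)" if "z \<in> cball a (5 * \<rho>)" for z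
    by (rule perron_family_bdd_above[OF P(1) G(1)]) (use that sub in blast)
  have upper: "f z \<le> \<Lambda> z" if "f \<in> \<Phi>" "z \<in> cball a (5 * \<rho>)" for f z
    unfolding \<Lambda>_def by (rule cSUP_upper[OF that(1) bdd[OF that(2)]])
  have above: "f z \<le> 1 / \<rho>" if "f \<in> \<Phi>" "z \<in> cball a (5 * \<rho>)" for f z
  proof -
    have "norm (z - a) \<le> 5 * \<rho>" using that(2) by (simp add: dist_norm norm_minus_commute)
    then have "(norm (z - a))\<^sup>2 \<le> (5 * \<rho>)\<^sup>2" by (rule power_mono) simp
    then have n: "75 * \<rho>\<^sup>2 \<le> (10 * \<rho>)\<^sup>2 - (norm (z - a))\<^sup>2" by (simp add: power_mult_distrib)
    have p: "0 < 75 * \<rho>\<^sup>2" using \<rho>(1) by simp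
    have "f z \<le> 6 * (10 * \<rho>) / ((10 * \<rho>)\<^sup>2 - (norm (z - a))\<^sup>2)"
      by (rule sk_metric_bound[OF sk[OF that(1)] \<rho>(2)]) (use that(2) sub in blast)
    also have "\<dots> \<le> 6 * (10 * \<rho>) / (75 * \<rho>\<^sup>2)"
      by (rule divide_left_mono[OF n _ mult_pos_pos[OF less_le_trans[OF p n] p]]) (use \<rho>(1) in simp)
    also have "\<dots> \<le> 1 / \<rho>" using \<rho>(1) by (simp add: field_simps power2_eq_square)
    finally show ?thesis .
  qed
  obtain \<mu> where \<mu>: "\<mu> \<in> \<Phi>" "\<And>z. z \<in> cball a (5 * \<rho>) \<Longrightarrow> 0 < \<mu> z"
    using perron_family_positive_on_cball[OF P G(1) sub(1)] by blast
  have "continuous_on (cball a (5 * \<rho>)) \<mu>"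
    using sk_metric_continuous[OF sk[OF \<mu>(1)]] sub(1) by (rule continuous_on_subset)
  moreover have "cball a (5 * \<rho>) \<noteq> {}" using \<rho>(1) by simp
  ultimately obtain m0 where m0: "m0 \<in> cball a (5 * \<rho>)" "\<And>z. z \<in> cball a (5 * \<rho>) \<Longrightarrow> \<mu> m0 \<le> \<mu> z"
    using continuous_attains_inf[OF compact_cball] by blast
  define B where "B = max \<bar>ln (\<mu> m0)\<bar> \<bar>ln (1 / \<rho>)\<bar>"
  define \<Psi> where "\<Psi> = {\<sigma> \<in> \<Phi>. regular_metric_curvature_minus_one (ball a (5 * \<rho>)) \<sigma> \<and> (\<forall>z\<in>cball a (5 * \<rho>). \<mu> z \<le> \<sigma> z)}"
  have \<Psi>\<Phi>: "\<sigma> \<in> \<Phi>" if "\<sigma> \<in> \<Psi>" for \<sigma> using that by (simp add: \<Psi>_def)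
  have \<Psi>pos: "0 < \<sigma> z" if "\<sigma> \<in> \<Psi>" "z \<in> cball a (5 * \<rho>)" for \<sigma> z
    using that \<mu>(2)[OF that(2)] by (force simp: \<Psi>_def)
  have \<Psi>B: "\<bar>ln (\<sigma> z)\<bar> \<le> B" if "\<sigma> \<in> \<Psi>" "z \<in> cball a (5 * \<rho>)" for \<sigma> z
  proof -
    have "\<mu> m0 \<le> \<sigma> z" using that m0(2)[OF that(2)] by (force simp: \<Psi>_def)
    then have "ln (\<mu> m0) \<le> ln (\<sigma> z)" using \<mu>(2)[OF m0(1)] by (intro ln_mono) auto
    moreover have "ln (\<sigma> z) \<le> ln (1 / \<rho>)"
      using above[OF \<Psi>\<Phi>[OF that(1)] that(2)] \<Psi>pos[OF that] \<rho>(1) by (intro ln_mono) auto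
    ultimately show ?thesis unfolding B_def by linarith
  qed
  have dom: "\<exists>\<sigma>\<in>\<Psi>. \<forall>z\<in>cball a (5 * \<rho>). f z \<le> \<sigma> z" if "f \<in> \<Phi>" for f
    using perron_family_dominating_modification[OF P(1) _ sub(1) \<mu> that] \<rho>(1) by (force simp: \<Psi>_def)
  have sol: "\<exists>g H. liouville_solution (ball a (5 * \<rho>)) (\<lambda>z. ln (\<sigma> z)) g H" if "\<sigma> \<in> \<Psi>" for \<sigma>
    by (rule curvature_minus_one_imp_liouville_solution) (use that in \<open>simp_all add: \<Psi>_def\<close>)
  have \<Lambda>pos: "0 < \<Lambda> z" if "z \<in> cball a (5 * \<rho>)" for z
    using \<mu>(2)[OF that] upper[OF \<mu>(1) that] by linarith
  obtain L where L: "L \<ge> 0" "\<forall>s g H a r z. liouville_solution (ball a (r + \<rho>)) s g H \<longrightarrow>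
       (\<forall>w\<in>ball a (r + \<rho>). \<bar>s w\<bar> \<le> B) \<longrightarrow> z \<in> ball a r \<longrightarrow> norm (g z) \<le> L"
    using liouville_gradient_bound[OF \<rho>(1)] by blast
  have lip: "\<bar>ln (\<sigma> x) - ln (\<sigma> y)\<bar> \<le> L * norm (x - y)"
    if \<sigma>: "\<sigma> \<in> \<Psi>" and xy: "x \<in> ball a (4 * \<rho>)" "y \<in> ball a (4 * \<rho>)" for \<sigma> x y
  proof -
    obtain g H where gH: "liouville_solution (ball a (5 * \<rho>)) (\<lambda>z. ln (\<sigma> z)) g H"
      using sol[OF \<sigma>] by blast
    have 5: "4 * \<rho> + \<rho> = 5 * \<rho>" by simp
    have "norm (g z) \<le> L" if "z \<in> ball a (4 * \<rho>)" for z
      by (rule L(2)[rule_format, of a "4 * \<rho>", unfolded 5, OF gH _ that]) (use \<Psi>B[OF \<sigma>] in simp)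
    moreover have "((\<lambda>z. ln (\<sigma> z)) has_derivative (\<lambda>h. Re (g z * h))) (at z)" if "z \<in> ball a (4 * \<rho>)" for z
    proof (rule has_C2_gradientD(1))
      show "has_C2_gradient (ball a (5 * \<rho>)) (\<lambda>z. ln (\<sigma> z)) g H" using gH by (simp add: liouville_solution_def)
      show "z \<in> ball a (5 * \<rho>)" using that \<rho>(1) by simp
    qed
    ultimately show ?thesis using xy by (intro gradient_lipschitz[of a "4 * \<rho>" _ g])
  qed
  have in5: "x \<in> cball a (5 * \<rho>)" if "x \<in> ball a (4 * \<rho>)" for x using that \<rho>(1) by simp
  have \<Lambda>lip: "ln (\<Lambda> x) \<le> ln (\<Lambda> y) + L * norm (x - y)"
    if xy: "x \<in> ball a (4 * \<rho>)" "y \<in> ball a (4 * \<rho>)" for x y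
  proof -
    have "\<Lambda> x = (SUP f\<in>\<Phi>. f x)" by (simp only: \<Lambda>_def)
    also have "\<dots> \<le> exp (ln (\<Lambda> y) + L * norm (x - y))"
    proof (rule cSUP_least[OF P(2)])
      fix f assume "f \<in> \<Phi>"
      then obtain \<sigma> where \<sigma>: "\<sigma> \<in> \<Psi>" "f x \<le> \<sigma> x" using dom in5[OF xy(1)] by blast
      have "f x \<le> exp (ln (\<sigma> x))" using \<sigma> \<Psi>pos[OF \<sigma>(1) in5[OF xy(1)]] by simp
      also have "ln (\<sigma> y) \<le> ln (\<Lambda> y)"
        using upper[OF \<Psi>\<Phi>[OF \<sigma>(1)] in5[OF xy(2)]] \<Psi>pos[OF \<sigma>(1) in5[OF xy(2)]] by (intro ln_mono) auto
      then have "exp (ln (\<sigma> x)) \<le> exp (ln (\<Lambda> y) + L * norm (x - y))"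
        using lip[OF \<sigma>(1) xy] by simp
      finally show "f x \<le> exp (ln (\<Lambda> y) + L * norm (x - y))" .
    qed
    finally have "ln (\<Lambda> x) \<le> ln (exp (ln (\<Lambda> y) + L * norm (x - y)))"
      using \<Lambda>pos[OF in5[OF xy(1)]] by (intro ln_mono) auto
    then show ?thesis by simp
  qed
  \<comment> \<open>\<open>\<Psi>\<close> is directed, so equicontinuity reduces uniform approximation of the supremum on the
    compact disk to approximation on a finite net.\<close>
  have approx: "\<exists>\<sigma>\<in>\<Psi>. \<forall>z\<in>ball a (3 * \<rho>). \<bar>ln (\<sigma> z) - ln (\<Lambda> z)\<bar> \<le> \<epsilon>" if \<epsilon>: "\<epsilon> > 0" for \<epsilon>
  proof -
    define \<delta> where "\<delta> = \<epsilon> / (4 * (L + 1))"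
    have \<delta>: "\<delta> > 0" "2 * (L * \<delta>) \<le> \<epsilon> / 2"
      using \<epsilon> L(1) by (auto simp: \<delta>_def field_simps intro: add_nonneg_pos)
    obtain D where D: "finite D" "D \<subseteq> cball a (3 * \<rho>)" "cball a (3 * \<rho>) \<subseteq> (\<Union>d\<in>D. ball d \<delta>)"
      using seq_compact_imp_totally_bounded[of "cball a (3 * \<rho>)"] \<delta>(1) compact_imp_seq_compact[OF compact_cball] by meson
    have D4: "d \<in> ball a (4 * \<rho>)" if "d \<in> D" for d using that D(2) \<rho>(1) by auto
    have "\<exists>f\<in>\<Phi>. \<forall>d\<in>D. exp (- \<epsilon> / 2) * \<Lambda> d < f d"
    proof (rule perron_family_finite_max[OF P D(1)])
      fix d assume d: "d \<in> D"
      have "exp (- \<epsilon> / 2) < 1" using \<epsilon> by simp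
      then have "exp (- \<epsilon> / 2) * \<Lambda> d < \<Lambda> d"
        using \<Lambda>pos[OF in5[OF D4[OF d]]] by simp
      then show "\<exists>f\<in>\<Phi>. exp (- \<epsilon> / 2) * \<Lambda> d < f d"
        using less_cSUP_iff[OF P(2) bdd[OF in5[OF D4[OF d]]]] unfolding \<Lambda>_def by blast
    qed (meson less_le_trans)
    then obtain f where f: "f \<in> \<Phi>" "\<And>d. d \<in> D \<Longrightarrow> exp (- \<epsilon> / 2) * \<Lambda> d < f d" by blast
    obtain \<sigma> where \<sigma>: "\<sigma> \<in> \<Psi>" "\<And>z. z \<in> cball a (5 * \<rho>) \<Longrightarrow> f z \<le> \<sigma> z" using dom[OF f(1)] by blast
    have "\<bar>ln (\<sigma> z) - ln (\<Lambda> z)\<bar> \<le> \<epsilon>" if z3: "z \<in> ball a (3 * \<rho>)" for z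
    proof -
      have z: "z \<in> ball a (4 * \<rho>)" using z3 \<rho>(1) by simp
      have "z \<in> cball a (3 * \<rho>)" using z3 by simp
      then obtain d where d: "d \<in> D" "norm (z - d) < \<delta>"
        using D(3) by (auto simp: dist_norm norm_minus_commute)
      note d4 = D4[OF d(1)]
      have "exp (- \<epsilon> / 2) * \<Lambda> d \<le> \<sigma> d"
        using f(2)[OF d(1)] \<sigma>(2)[OF in5[OF d4]] by linarith
      then have "ln (exp (- \<epsilon> / 2) * \<Lambda> d) \<le> ln (\<sigma> d)"
        using \<Lambda>pos[OF in5[OF d4]] by (intro ln_mono) auto
      then have "ln (\<Lambda> d) - \<epsilon> / 2 \<le> ln (\<sigma> d)"
        using \<Lambda>pos[OF in5[OF d4]] by (simp add: ln_mult)
      moreover have "L * norm (z - d) \<le> L * \<delta>" using d(2) L(1) by (intro mult_left_mono) auto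
      moreover have "ln (\<Lambda> z) \<le> ln (\<Lambda> d) + L * norm (z - d)" by (rule \<Lambda>lip[OF z d4])
      moreover have "\<bar>ln (\<sigma> z) - ln (\<sigma> d)\<bar> \<le> L * norm (z - d)" by (rule lip[OF \<sigma>(1) z d4])
      moreover have "ln (\<sigma> z) \<le> ln (\<Lambda> z)"
        using upper[OF \<Psi>\<Phi>[OF \<sigma>(1)] in5[OF z]] \<Psi>pos[OF \<sigma>(1) in5[OF z]] by (intro ln_mono) auto
      ultimately show ?thesis using \<delta>(2) by linarith
    qed
    then show ?thesis using \<sigma>(1) by blast
  qed
  have "\<forall>n. \<exists>\<sigma>\<in>\<Psi>. \<forall>z\<in>ball a (3 * \<rho>). \<bar>ln (\<sigma> z) - ln (\<Lambda> z)\<bar> \<le> 1 / real (Suc n)"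
    by (intro allI approx) simp
  then obtain \<sigma> where \<sigma>: "\<And>n. \<sigma> n \<in> \<Psi>"
    "\<And>n z. z \<in> ball a (3 * \<rho>) \<Longrightarrow> \<bar>ln (\<sigma> n z) - ln (\<Lambda> z)\<bar> \<le> 1 / real (Suc n)" by metis
  have ulim: "uniform_limit (ball a (3 * \<rho>)) (\<lambda>n z. ln (\<sigma> n z)) (\<lambda>z. ln (\<Lambda> z)) sequentially"
  proof (rule uniform_limitI)
    fix e :: real assume "e > 0"
    then obtain N where N: "1 / real (Suc N) < e" using nat_approx_posE by blast
    show "\<forall>\<^sub>F n in sequentially. \<forall>z\<in>ball a (3 * \<rho>). dist (ln (\<sigma> n z)) (ln (\<Lambda> z)) < e"
      using eventually_ge_at_top[of N]
    proof (eventually_elim, intro ballI)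
      fix n z assume "N \<le> n" and z: "z \<in> ball a (3 * \<rho>)"
      then have "1 / real (Suc n) \<le> 1 / real (Suc N)" by (simp add: frac_le)
      then show "dist (ln (\<sigma> n z)) (ln (\<Lambda> z)) < e"
        using \<sigma>(2)[OF z, of n] N by (simp add: dist_real_def)
    qed
  qed
  have "\<forall>n. \<exists>g H. liouville_solution (ball a (5 * \<rho>)) (\<lambda>z. ln (\<sigma> n z)) g H"
    using sol \<sigma>(1) by blast
  then obtain g H where gH: "\<And>n. liouville_solution (ball a (5 * \<rho>)) (\<lambda>z. ln (\<sigma> n z)) (g n) (H n)"
    by metis
  have gH4: "liouville_solution (ball a (4 * \<rho>)) (\<lambda>z. ln (\<sigma> n z)) (g n) (H n)" for n
    using gH[of n] \<rho>(1) has_C2_gradient_subset[of "ball a (5 * \<rho>)" _ _ _ "ball a (4 * \<rho>)"]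
    by (auto simp: liouville_solution_def subset_ball)
  have "\<exists>\<gamma> \<Gamma>. liouville_solution (ball a \<rho>) (\<lambda>z. ln (\<Lambda> z)) \<gamma> \<Gamma>"
    by (rule liouville_uniform_limit[OF \<rho>(1) gH4 _ ulim, where B = B]) (use \<Psi>B[OF \<sigma>(1)] in5 in simp)
  moreover have "\<forall>z\<in>ball a \<rho>. 0 < \<Lambda> z" using \<Lambda>pos \<rho>(1) by simp
  moreover have "ball a \<rho> \<subseteq> G"
  proof -
    have "ball a \<rho> \<subseteq> cball a (5 * \<rho>)" using \<rho>(1) by auto
    then show ?thesis using sub(1) by blast
  qed
  ultimately show ?thesis using \<rho>(1) by blast
qed

theorem theorem4p12:
  fixes G :: "complex set" and \<Phi> :: "(complex \<Rightarrow> real) set"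
  assumes "open G" and "connected G" and "G \<noteq> {}"
    and "perron_family G \<Phi>"
    and "\<Phi> \<noteq> {}"
  shows "(\<forall>z\<in>G. bdd_above ((\<lambda>f. f z) ` \<Phi>)) \<and>
         regular_metric_curvature_minus_one G (\<lambda>z. SUP f\<in>\<Phi>. f z)"
proof
  show "\<forall>z\<in>G. bdd_above ((\<lambda>f. f z) ` \<Phi>)"
    by (intro ballI perron_family_bdd_above[OF assms(4,1)])
  define \<Lambda> where "\<Lambda> = (\<lambda>z. SUP f\<in>\<Phi>. f z)"
  have loc: "\<exists>\<rho>>0. ball a \<rho> \<subseteq> G \<and> (\<forall>z\<in>ball a \<rho>. 0 < \<Lambda> z) \<and>
    (\<exists>g H. liouville_solution (ball a \<rho>) (\<lambda>z. ln (\<Lambda> z)) g H)" if "a \<in> G" for a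
    unfolding \<Lambda>_def by (rule perron_sup_local_solution[OF assms(4,5,1) that])
  have pos: "0 < \<Lambda> z" if "z \<in> G" for z
    using loc[OF that] by auto
  have C2: "C2_on G \<Lambda>"
  proof (rule C2_on_locally)
    fix a assume "a \<in> G"
    then obtain \<rho> g H where \<rho>: "\<rho> > 0" "ball a \<rho> \<subseteq> G" "\<And>z. z \<in> ball a \<rho> \<Longrightarrow> 0 < \<Lambda> z"
      "has_C2_gradient (ball a \<rho>) (\<lambda>z. ln (\<Lambda> z)) g H"
      using loc unfolding liouville_solution_def by blast
    have "C2_on (ball a \<rho>) (\<lambda>z. exp (1 * ln (\<Lambda> z)))"
      using has_C2_gradient_exp[OF \<rho>(4), of 1] C2_on_iff_gradient by blast
    then have "C2_on (ball a \<rho>) \<Lambda>"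
      by (rule C2_on_cong[OF open_ball, rotated]) (use \<rho>(3) in simp)
    then show "\<exists>r>0. ball a r \<subseteq> G \<and> C2_on (ball a r) \<Lambda>" using \<rho>(1,2) by blast
  qed
  have cont: "continuous_on G \<Lambda>"
    using C2 has_C2_gradientD(3) unfolding C2_on_iff_gradient by blast
  have curv: "curvature \<Lambda> z = -1" if z: "z \<in> G" for z
  proof -
    obtain \<rho> g H where \<rho>: "\<rho> > 0" "liouville_solution (ball z \<rho>) (\<lambda>z. ln (\<Lambda> z)) g H"
      using loc[OF z] by blast
    show ?thesis
      by (rule liouville_solution_imp_curvature_minus_one[OF open_ball _ \<rho>(2) pos[OF z]]) (use \<rho>(1) in simp)
  qed
  have "{z \<in> G. 0 < \<Lambda> z} = G" using pos by auto
  moreover have "\<exists>z\<in>G. \<Lambda> z \<noteq> 0" using assms(3) pos by force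
  ultimately have "regular_metric_curvature_minus_one G \<Lambda>"
    using C2 cont curv pos
    by (auto simp: regular_metric_curvature_minus_one_def conformal_metric_def
        conformal_pseudo_metric_def regular_on_def intro: less_imp_le)
  then show "regular_metric_curvature_minus_one G (\<lambda>z. SUP f\<in>\<Phi>. f z)"
    unfolding \<Lambda>_def .
qed

end
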